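(* Let $U$ be an open subset of a complex Banach space $E$, let $F$ be a complex Banach space and let $f\in\mathcal{H}^\infty(U,F)$. The following are equivalent: (1) $f\colon U\to F$ has relatively compact range. (2) $T_f\colon\mathcal{G}^\infty(U)\to F$ is compact. (3) $f^t\colon F^*\to\mathcal{H}^\infty(U)$ is compact. (4) $f^t\colon F^*\to\mathcal{H}^\infty(U)$ is bounded-weak*-to-norm continuous. (5) $f^t\colon F^*\to\mathcal{H}^\infty(U)$ is compact and bounded-weak*-to-weak continuous. (6) $f^t\colon F^*\to\mathcal{H}^\infty(U)$ is compact and weak*-to-weak continuous.
   Context: $\mathcal{H}^\infty(U,F)$ is the Banach space of all bounded holomorphic mappings $f\colon U\to F$ with the supremum norm $\|f\|_\infty=\sup_{x\in U}\|f(x)\|$, and $\mathcal{H}^\infty(U)=\mathcal{H}^\infty(U,\mathbb{C})$. For $x\in U$, $\delta(x)\in\mathcal{H}^\infty(U)^*$ is the evaluation functional $\delta(x)(g)=g(x)$. $\mathcal{G}^\infty(U)$ is the norm-closed linear span of $\{\delta(x)\colon x\in U\}$ in $\mathcal{H}^\infty(U)^*$, and $\delta_U\colon U\to\mathcal{G}^\infty(U)$ is $\delta_U(x)=\delta(x)$. By Mujica's linearization theorem, $\delta_U$ is holomorphic and for each $f\in\mathcal{H}^\infty(U,F)$ there is a unique continuous linear operator $T_f\colon\mathcal{G}^\infty(U)\to F$ with $T_f\circ\delta_U=f$. The transpose of $f$ is the linear mapping $f^t\colon F^*\to\mathcal{H}^\infty(U)$, $f^t(\varphi)=\varphi\circ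 f$. A bounded linear operator between Banach spaces is compact if the image of the closed unit ball is relatively compact. The range $f(U)$ is relatively compact if its norm closure in $F$ is compact. The bounded weak* topology on $F^*$ is the topology whose closed sets are the sets $A\subseteq F^*$ such that $A\cap tB_{F^*}$ is weak*-closed for every $t>0$, where $B_{F^*}$ is the closed unit ball of $F^*$. "Norm" and "weak" on $\mathcal{H}^\infty(U)$ refer to its supremum-norm topology and its weak topology as a Banach space. *)

theory Defs
  imports "HOL-Analysis.Analysis" "HOL-Library.Function_Algebras"
begin

section \<open>Complex Banach spaces\<close>

class complex_vector = ab_group_add +
  fixes scaleC :: "complex \<Rightarrow> 'a \<Rightarrow> 'a" (infixr "*\<^sub>C" 75)
  assumes scaleC_add_right: "a *\<^sub>C (x + y) = a *\<^sub>C x + a *\<^sub>C y"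
    and scaleC_add_left: "(a + b) *\<^sub>C x = a *\<^sub>C x + b *\<^sub>C x"
    and scaleC_scaleC: "a *\<^sub>C b *\<^sub>C x = (a * b) *\<^sub>C x"
    and scaleC_one: "1 *\<^sub>C x = x"

class complex_normed_vector = complex_vector + real_normed_vector +
  assumes scaleR_scaleC: "scaleR r x = complex_of_real r *\<^sub>C x"
    and norm_scaleC: "norm (a *\<^sub>C x) = cmod a * norm x"

class complex_banach = complex_normed_vector + banach

instantiation complex :: complex_banach
begin

definition scaleC_complex :: "complex \<Rightarrow> complex \<Rightarrow> complex"
  where "scaleC_complex a x = a * x"

instance
  by standard
    (auto simp: scaleC_complex_def algebra_simps norm_mult scaleR_conv_of_real)

end

instantiation "fun" :: (type, complex_vector) complex_vector
begin

definition scaleC_fun :: "complex \<Rightarrow> ('a \<Rightarrow> 'b) \<Rightarrow> 'a \<Rightarrow> 'b"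
  where "scaleC_fun a f = (\<lambda>x. a *\<^sub>C f x)"

instance
  by standard
    (auto simp: scaleC_fun_def fun_eq_iff
      scaleC_add_right scaleC_add_left scaleC_scaleC scaleC_one)

end

lemma vector_space_scaleC: "vector_space (scaleC :: complex \<Rightarrow> 'v::complex_vector \<Rightarrow> 'v)"
  by standard (auto simp: scaleC_add_right scaleC_add_left scaleC_scaleC scaleC_one)


section \<open>Normed spaces given by a carrier and a norm\<close>

text \<open>
  The spaces of holomorphic maps on U, their duals and the predual depend on the set U, so they
  are not types. Below, a normed space is a linear subspace V of a complex vector space
  together with a norm N on V. A space of maps on a set X is represented by total
  functions that vanish outside X, so that equality of maps on X is equality in the logic.
\<close>

definition cball_on :: "'v set \<Rightarrow> ('v \<Rightarrow> real) \<Rightarrow> real \<Rightarrow> 'v set"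
  where "cball_on V N t = {x \<in> V. N x \<le> t}"

text \<open>The case distinction makes the distance non-negative and symmetric on the whole type,
  as the locale \<^locale>\<open>Metric_space\<close> requires; only the values on V matter.\<close>

definition norm_dist :: "'v::complex_vector set \<Rightarrow> ('v \<Rightarrow> real) \<Rightarrow> 'v \<Rightarrow> 'v \<Rightarrow> real"
  where "norm_dist V N x y = (if x \<in> V \<and> y \<in> V then N (x - y) else 0)"

definition norm_topology :: "'v::complex_vector set \<Rightarrow> ('v \<Rightarrow> real) \<Rightarrow> 'v topology"
  where "norm_topology V N = Metric_space.mtopology V (norm_dist V N)"

definition bounded_op ::
  "'v::complex_vector set \<Rightarrow> ('v \<Rightarrow> real) \<Rightarrow> 'w::complex_vector set \<Rightarrow> ('w \<Rightarrow> real) \<Rightarrow> ('v \<Rightarrow> 'w) \<Rightarrow> bool"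
  where "bounded_op V N W M T \<longleftrightarrow>
    T ` V \<subseteq> W \<and>
    (\<forall>x\<in>V. \<forall>y\<in>V. T (x + y) = T x + T y) \<and>
    (\<forall>a. \<forall>x\<in>V. T (a *\<^sub>C x) = a *\<^sub>C T x) \<and>
    (\<exists>K. \<forall>x\<in>V. M (T x) \<le> K * N x)"

definition compact_op ::
  "'v::complex_vector set \<Rightarrow> ('v \<Rightarrow> real) \<Rightarrow> 'w::complex_vector set \<Rightarrow> ('w \<Rightarrow> real) \<Rightarrow> ('v \<Rightarrow> 'w) \<Rightarrow> bool"
  where "compact_op V N W M T \<longleftrightarrow>
    bounded_op V N W M T \<and>
    compactin (norm_topology W M) (norm_topology W M closure_of (T ` cball_on V N 1))"

text \<open>The real supremum of the empty set is unspecified in the library, hence the case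
  distinction.\<close>

definition sup_norm :: "'a set \<Rightarrow> ('a \<Rightarrow> 'b::real_normed_vector) \<Rightarrow> real"
  where "sup_norm X f = (if X = {} then 0 else SUP x\<in>X. norm (f x))"

definition cdual :: "'v::complex_vector set \<Rightarrow> ('v \<Rightarrow> real) \<Rightarrow> ('v \<Rightarrow> complex) set"
  where "cdual V N = {\<phi>. bounded_op V N UNIV cmod \<phi> \<and> (\<forall>x. x \<notin> V \<longrightarrow> \<phi> x = 0)}"

definition cdual_norm :: "'v::complex_vector set \<Rightarrow> ('v \<Rightarrow> real) \<Rightarrow> ('v \<Rightarrow> complex) \<Rightarrow> real"
  where "cdual_norm V N = sup_norm (cball_on V N 1)"

definition weak_topology :: "'v::complex_vector set \<Rightarrow> ('v \<Rightarrow> real) \<Rightarrow> 'v topology"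
  where "weak_topology V N =
    topology_generated_by {{x \<in> V. \<phi> x \<in> S} | \<phi> S. \<phi> \<in> cdual V N \<and> open S}"

definition weak_star_topology ::
    "'v::complex_vector set \<Rightarrow> ('v \<Rightarrow> real) \<Rightarrow> ('v \<Rightarrow> complex) topology"
  where "weak_star_topology V N =
    topology_generated_by {{\<phi> \<in> cdual V N. \<phi> x \<in> S} | x S. x \<in> V \<and> open S}"

definition bw_star_closed ::
    "'v::complex_vector set \<Rightarrow> ('v \<Rightarrow> real) \<Rightarrow> ('v \<Rightarrow> complex) set \<Rightarrow> bool"
  where "bw_star_closed V N A \<longleftrightarrow>
    A \<subseteq> cdual V N \<and>
    (\<forall>t>0. closedin (weak_star_topology V N) (A \<inter> cball_on (cdual V N) (cdual_norm V N) t))"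

definition bw_star_topology ::
    "'v::complex_vector set \<Rightarrow> ('v \<Rightarrow> real) \<Rightarrow> ('v \<Rightarrow> complex) topology"
  where "bw_star_topology V N =
    topology (\<lambda>G. G \<subseteq> cdual V N \<and> bw_star_closed V N (cdual V N - G))"


section \<open>Bounded holomorphic maps and the predual\<close>

definition holomorphic_map ::
    "'e::complex_normed_vector set \<Rightarrow> ('e \<Rightarrow> 'f::complex_normed_vector) \<Rightarrow> bool"
  where "holomorphic_map U f \<longleftrightarrow>
    (\<forall>x\<in>U. \<exists>D. (f has_derivative D) (at x) \<and> (\<forall>a v. D (a *\<^sub>C v) = a *\<^sub>C D v))"

definition Hinf :: "'e::complex_normed_vector set \<Rightarrow> ('e \<Rightarrow> 'f::complex_normed_vector) set"
  where "Hinf U = {f. holomorphic_map U f \<and> bounded (f ` U) \<and> (\<forall>x. x \<notin> U \<longrightarrow> f x = 0)}"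

abbreviation Hinf_dual :: "'e::complex_normed_vector set \<Rightarrow> (('e \<Rightarrow> complex) \<Rightarrow> complex) set"
  where "Hinf_dual U \<equiv> cdual (Hinf U) (sup_norm U)"

abbreviation Hinf_dual_norm ::
    "'e::complex_normed_vector set \<Rightarrow> (('e \<Rightarrow> complex) \<Rightarrow> complex) \<Rightarrow> real"
  where "Hinf_dual_norm U \<equiv> cdual_norm (Hinf U) (sup_norm U)"

definition evaluation ::
    "'e::complex_normed_vector set \<Rightarrow> 'e \<Rightarrow> ('e \<Rightarrow> complex) \<Rightarrow> complex"
  where "evaluation U x = (\<lambda>g. if g \<in> Hinf U then g x else 0)"

definition Ginf :: "'e::complex_normed_vector set \<Rightarrow> (('e \<Rightarrow> complex) \<Rightarrow> complex) set"
  where "Ginf U =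
    norm_topology (Hinf_dual U) (Hinf_dual_norm U) closure_of
      (module.span scaleC (evaluation U ` U))"

text \<open>The operator of Mujica's linearization theorem, which provides existence and uniqueness.\<close>

definition linearization ::
    "'e::complex_normed_vector set \<Rightarrow> ('e \<Rightarrow> 'f::complex_normed_vector) \<Rightarrow>
      (('e \<Rightarrow> complex) \<Rightarrow> complex) \<Rightarrow> 'f"
  where "linearization U f = (THE T.
    bounded_op (Ginf U) (Hinf_dual_norm U) UNIV norm T \<and>
    (\<forall>u. u \<notin> Ginf U \<longrightarrow> T u = 0) \<and>
    (\<forall>x\<in>U. T (evaluation U x) = f x))"

text \<open>For f in the space of bounded holomorphic maps on U and a functional \<open>\<phi>\<close>, the composition
  vanishes outside U because f does, so no further restriction is needed.\<close>

definition transpose_map :: "('e \<Rightarrow> 'f) \<Rightarrow> ('f \<Rightarrow> complex) \<Rightarrow> 'e \<Rightarrow> complex"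
  where "transpose_map f \<phi> = \<phi> \<circ> f"


section \<open>Well-definedness of the topologies\<close>

lemma cdual_zero: "(\<lambda>_. 0) \<in> cdual V N"
  by (auto simp: cdual_def bounded_op_def scaleC_complex_def intro!: exI[of _ 0])

lemma topspace_weak_topology [simp]: "topspace (weak_topology V N) = V"
  unfolding weak_topology_def topology_generated_by_topspace
  using cdual_zero[of V N] open_UNIV by blast

lemma topspace_weak_star_topology [simp]:
  assumes "V \<noteq> {}"
  shows "topspace (weak_star_topology V N) = cdual V N"
  unfolding weak_star_topology_def topology_generated_by_topspace
  using assms open_UNIV by blast

lemma sup_norm_le_iff:
  assumes "bounded (f ` X)" "0 \<le> t"
  shows "sup_norm X f \<le> t \<longleftrightarrow> (\<forall>x\<in>X. norm (f x) \<le> t)"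
proof -
  have "bdd_above ((\<lambda>x. norm (f x)) ` X)"
    using assms(1) by (auto simp: bounded_iff bdd_above_def)
  with assms(2) show ?thesis by (auto simp: sup_norm_def cSUP_le_iff)
qed

lemma Metric_space_sup_norm:
  fixes V :: "('a \<Rightarrow> 'b::complex_normed_vector) set"
  assumes bdd: "\<And>f. f \<in> V \<Longrightarrow> bounded (f ` X)"
    and eq: "\<And>f g. \<lbrakk>f \<in> V; g \<in> V; \<And>x. x \<in> X \<Longrightarrow> f x = g x\<rbrakk> \<Longrightarrow> f = g"
  shows "Metric_space V (norm_dist V (sup_norm X))"
proof -
  have bd: "bounded ((f - g) ` X)" if "f \<in> V" "g \<in> V" for f g
    using bounded_minus_comp[OF bdd[OF that(1)] bdd[OF that(2)]] by (simp add: fun_diff_def)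
  have nn: "0 \<le> sup_norm X (f - g)" if "f \<in> V" "g \<in> V" for f g
  proof (cases "X = {}")
    case False
    then obtain x where "x \<in> X" by blast
    have "bdd_above ((\<lambda>x. norm ((f - g) x)) ` X)"
      using bd[OF that] by (auto simp: bounded_iff bdd_above_def)
    then have "norm ((f - g) x) \<le> sup_norm X (f - g)"
      using \<open>x \<in> X\<close> by (auto simp: sup_norm_def intro: cSUP_upper)
    then show ?thesis by (rule order_trans[OF norm_ge_zero])
  qed (simp add: sup_norm_def)
  have pt: "norm (f x - g x) \<le> sup_norm X (f - g)" if "f \<in> V" "g \<in> V" "x \<in> X" for f g x
    using sup_norm_le_iff[OF bd[OF that(1,2)] nn[OF that(1,2)]] that(3) by auto
  show ?thesis
  proof
    fix f g show "0 \<le> norm_dist V (sup_norm X) f g"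
      by (simp add: norm_dist_def nn)
  next
    fix f g show "norm_dist V (sup_norm X) f g = norm_dist V (sup_norm X) g f"
      by (simp add: norm_dist_def sup_norm_def norm_minus_commute)
  next
    fix f g assume fg: "f \<in> V" "g \<in> V"
    show "norm_dist V (sup_norm X) f g = 0 \<longleftrightarrow> f = g"
    proof
      assume "norm_dist V (sup_norm X) f g = 0"
      then have "f x = g x" if "x \<in> X" for x
        using pt[OF fg that] fg by (simp add: norm_dist_def)
      then show "f = g" by (rule eq[OF fg])
    qed (simp add: norm_dist_def sup_norm_def)
  next
    fix f g h assume fgh: "f \<in> V" "g \<in> V" "h \<in> V"
    have "norm (f x - h x) \<le> sup_norm X (f - g) + sup_norm X (g - h)" if "x \<in> X" for x
      using pt[of f g x] pt[of g h x] fgh that norm_triangle_ineq[of "f x - g x" "g x - h x"]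
      by simp
    then have "sup_norm X (f - h) \<le> sup_norm X (f - g) + sup_norm X (g - h)"
      using sup_norm_le_iff[OF bd] nn fgh by (simp add: add_nonneg_nonneg)
    then show "norm_dist V (sup_norm X) f h
        \<le> norm_dist V (sup_norm X) f g + norm_dist V (sup_norm X) g h"
      using fgh by (simp add: norm_dist_def)
  qed
qed

lemma Metric_space_Hinf:
  "Metric_space (Hinf U :: ('e::complex_normed_vector \<Rightarrow> 'f::complex_normed_vector) set)
    (norm_dist (Hinf U) (sup_norm U))"
  by (rule Metric_space_sup_norm) (auto simp: Hinf_def fun_eq_iff, metis)

lemma bounded_cdual:
  assumes "\<And>x. x \<in> V \<Longrightarrow> 0 \<le> N x" "\<phi> \<in> cdual V N"
  shows "bounded (\<phi> ` cball_on V N 1)"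
proof -
  obtain K where K: "\<And>x. x \<in> V \<Longrightarrow> cmod (\<phi> x) \<le> K * N x"
    using assms(2) unfolding cdual_def bounded_op_def by blast
  have "cmod (\<phi> x) \<le> \<bar>K\<bar>" if "x \<in> V" "N x \<le> 1" for x
  proof -
    have "K * N x \<le> \<bar>K\<bar> * 1" by (rule mult_mono) (use that assms(1) in auto)
    with K[OF that(1)] show ?thesis by linarith
  qed
  then show ?thesis by (auto simp: bounded_iff cball_on_def)
qed

lemma Metric_space_cdual:
  assumes nn: "\<And>x. x \<in> V \<Longrightarrow> 0 \<le> N x"
    and sc: "\<And>a x. x \<in> V \<Longrightarrow> a *\<^sub>C x \<in> V \<and> N (a *\<^sub>C x) = cmod a * N x"
  shows "Metric_space (cdual V N) (norm_dist (cdual V N) (cdual_norm V N))"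
  unfolding cdual_norm_def
proof (rule Metric_space_sup_norm)
  fix \<phi> \<psi> assume *: "\<phi> \<in> cdual V N" "\<psi> \<in> cdual V N"
    and eq: "\<And>x. x \<in> cball_on V N 1 \<Longrightarrow> \<phi> x = \<psi> x"
  show "\<phi> = \<psi>"
  proof
    fix x show "\<phi> x = \<psi> x"
    proof (cases "x \<in> V")
      case True
      define r where "r = 1 / (N x + 1)"
      have "r > 0" "r * N x \<le> 1"
        using nn[OF True] by (auto simp: r_def divide_simps)
      then have "complex_of_real r *\<^sub>C x \<in> cball_on V N 1"
        using sc[OF True, of "complex_of_real r"] by (simp add: cball_on_def)
      from eq[OF this] have "complex_of_real r * \<phi> x = complex_of_real r * \<psi> x"
        using * True by (simp add: cdual_def bounded_op_def scaleC_complex_def)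
      with \<open>r > 0\<close> show ?thesis by simp
    qed (use * in \<open>simp add: cdual_def\<close>)
  qed
qed (rule bounded_cdual[OF nn])

lemma holomorphic_map_scaleC:
  fixes f :: "'e::complex_normed_vector \<Rightarrow> 'f::complex_normed_vector"
  assumes "holomorphic_map U f"
  shows "holomorphic_map U (a *\<^sub>C f)"
  unfolding holomorphic_map_def
proof
  have bl: "bounded_linear (\<lambda>y::'f. a *\<^sub>C y)"
    by (rule bounded_linear_intro[where K = "cmod a"])
      (simp_all add: scaleC_add_right scaleR_scaleC scaleC_scaleC norm_scaleC mult.commute)
  fix x assume "x \<in> U"
  then obtain D where D: "(f has_derivative D) (at x)" "\<And>b v. D (b *\<^sub>C v) = b *\<^sub>C D v"
    using assms by (auto simp: holomorphic_map_def)
  show "\<exists>D. (a *\<^sub>C f has_derivative D) (at x) \<and> (\<forall>b v. D (b *\<^sub>C v) = b *\<^sub>C D v)"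
    using bounded_linear.has_derivative[OF bl D(1)] D(2)
    by (intro exI[of _ "\<lambda>v. a *\<^sub>C D v"]) (simp add: scaleC_fun_def scaleC_scaleC mult.commute)
qed

lemma scaleC_zero_right [simp]: "a *\<^sub>C (0::'a::complex_vector) = 0"
  using scaleC_add_right[of a 0 0] by simp

lemma sup_norm_nonneg:
  assumes "bounded (f ` X)"
  shows "0 \<le> sup_norm X f"
proof (cases "X = {}")
  case False
  then obtain x where "x \<in> X" by blast
  have "bdd_above ((\<lambda>x. norm (f x)) ` X)"
    using assms by (auto simp: bounded_iff bdd_above_def)
  then have "norm (f x) \<le> sup_norm X f"
    using \<open>x \<in> X\<close> by (auto simp: sup_norm_def intro: cSUP_upper)
  then show ?thesis by (rule order_trans[OF norm_ge_zero])
qed (simp add: sup_norm_def)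

lemma Hinf_scaleC:
  fixes f :: "'e::complex_normed_vector \<Rightarrow> 'f::complex_normed_vector"
  assumes "f \<in> Hinf U"
  shows "a *\<^sub>C f \<in> Hinf U \<and> sup_norm U (a *\<^sub>C f) = cmod a * sup_norm U f"
proof
  have b: "bounded (f ` U)" using assms by (simp add: Hinf_def)
  then obtain K where K: "\<And>x. x \<in> U \<Longrightarrow> norm (f x) \<le> K" by (auto simp: bounded_iff)
  have b': "bounded ((a *\<^sub>C f) ` U)"
    by (auto simp: bounded_iff scaleC_fun_def norm_scaleC
        intro!: exI[of _ "cmod a * K"] mult_left_mono K)
  show "a *\<^sub>C f \<in> Hinf U"
    using assms b' by (simp add: Hinf_def holomorphic_map_scaleC) (simp add: scaleC_fun_def)
  show "sup_norm U (a *\<^sub>C f) = cmod a * sup_norm U f"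
  proof (cases "a = 0 \<or> U = {}")
    case True
    then show ?thesis by (cases "U = {}") (auto simp: sup_norm_def scaleC_fun_def norm_scaleC)
  next
    case False
    have s: "0 \<le> sup_norm U f" "0 \<le> sup_norm U (a *\<^sub>C f)"
      by (rule sup_norm_nonneg[OF b] sup_norm_nonneg[OF b'])+
    have "\<forall>x\<in>U. norm (f x) \<le> sup_norm U f"
      using sup_norm_le_iff[OF b s(1)] by simp
    then have "sup_norm U (a *\<^sub>C f) \<le> cmod a * sup_norm U f"
      using sup_norm_le_iff[OF b', of "cmod a * sup_norm U f"] s(1)
      by (simp add: scaleC_fun_def norm_scaleC mult_left_mono)
    moreover have "\<forall>x\<in>U. cmod a * norm (f x) \<le> sup_norm U (a *\<^sub>C f)"
      using sup_norm_le_iff[OF b' s(2)] by (simp add: scaleC_fun_def norm_scaleC)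
    then have "sup_norm U f \<le> sup_norm U (a *\<^sub>C f) / cmod a"
      using sup_norm_le_iff[OF b, of "sup_norm U (a *\<^sub>C f) / cmod a"] s(2) False
      by (simp add: field_simps)
    then have "cmod a * sup_norm U f \<le> sup_norm U (a *\<^sub>C f)"
      using False by (simp add: field_simps)
    ultimately show ?thesis by simp
  qed
qed

lemma Metric_space_Hinf_dual:
  "Metric_space (Hinf_dual U) (norm_dist (Hinf_dual U) (Hinf_dual_norm U))"
proof (rule Metric_space_cdual)
  show "0 \<le> sup_norm U g" if "g \<in> Hinf U" for g :: "'a \<Rightarrow> complex"
    using that by (intro sup_norm_nonneg) (simp add: Hinf_def)
qed (rule Hinf_scaleC)

lemma Metric_space_cdual_UNIV:
  "Metric_space (cdual UNIV (norm :: 'f::complex_normed_vector \<Rightarrow> real))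
    (norm_dist (cdual UNIV norm) (cdual_norm UNIV norm))"
  by (rule Metric_space_cdual) (auto simp: norm_scaleC)

lemma norm_topology_UNIV:
  "norm_topology UNIV norm = (euclidean :: 'f::complex_normed_vector topology)"
proof -
  have "norm_dist UNIV norm = (dist :: 'f \<Rightarrow> 'f \<Rightarrow> real)"
    by (simp add: norm_dist_def fun_eq_iff dist_norm)
  then show ?thesis by (simp add: norm_topology_def)
qed

lemma closedin_weak_star_cball_on:
  assumes "V \<noteq> {}" and nn: "\<And>x. x \<in> V \<Longrightarrow> 0 \<le> N x" and "0 \<le> t"
  shows "closedin (weak_star_topology V N) (cball_on (cdual V N) (cdual_norm V N) t)"
proof -
  let ?D = "cdual V N" and ?B = "cball_on V N 1"
  have "cball_on ?D (cdual_norm V N) t = {\<phi> \<in> ?D. \<forall>x\<in>?B. cmod (\<phi> x) \<le> t}"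
    using sup_norm_le_iff[OF bounded_cdual[of V N] \<open>0 \<le> t\<close>] nn
    by (auto simp: cball_on_def[of ?D] cdual_norm_def)
  moreover have "?D - {\<phi> \<in> ?D. \<forall>x\<in>?B. cmod (\<phi> x) \<le> t} =
      (\<Union>x\<in>?B. {\<phi> \<in> ?D. \<phi> x \<in> - cball 0 t})"
    by auto
  moreover have "openin (weak_star_topology V N) {\<phi> \<in> ?D. \<phi> x \<in> - cball 0 t}" if "x \<in> ?B" for x
    unfolding weak_star_topology_def
    by (rule topology_generated_by_Basis)
      (use that in \<open>auto simp: cball_on_def intro!: exI[of _ x] exI[of _ "- cball 0 t"]\<close>)
  ultimately show ?thesis
    using assms(1) by (auto simp: closedin_def cball_on_def[of ?D])
qed

lemma istopology_bw_star:
  assumes "V \<noteq> {}" and "\<And>x. x \<in> V \<Longrightarrow> 0 \<le> N x"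
  shows "istopology (\<lambda>G. G \<subseteq> cdual V N \<and> bw_star_closed V N (cdual V N - G))"
proof -
  let ?D = "cdual V N" and ?B = "cball_on (cdual V N) (cdual_norm V N)"
  let ?W = "weak_star_topology V N"
  have int: "bw_star_closed V N (?D - (S \<inter> T))"
    if "bw_star_closed V N (?D - S)" "bw_star_closed V N (?D - T)" for S T
  proof -
    have "(?D - (S \<inter> T)) \<inter> ?B t = ((?D - S) \<inter> ?B t) \<union> ((?D - T) \<inter> ?B t)" for t by blast
    with that show ?thesis by (auto simp: bw_star_closed_def intro!: closedin_Un)
  qed
  have un: "bw_star_closed V N (?D - \<Union>\<G>)"
    if *: "\<And>G. G \<in> \<G> \<Longrightarrow> bw_star_closed V N (?D - G)" for \<G>
  proof -
    have eq: "(?D - \<Union>\<G>) \<inter> ?B t = \<Inter> (insert (?B t) ((\<lambda>G. (?D - G) \<inter> ?B t) ` \<G>))" for t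
      by (auto simp: cball_on_def)
    have "closedin ?W ((?D - \<Union>\<G>) \<inter> ?B t)" if "t > 0" for t
      unfolding eq using * \<open>t > 0\<close> closedin_weak_star_cball_on[of V N t] assms
      by (intro closedin_Inter) (auto simp: bw_star_closed_def)
    then show ?thesis by (auto simp: bw_star_closed_def)
  qed
  show ?thesis
    unfolding istopology_def by (auto intro: int un)
qed

lemma closedin_bw_star:
  assumes "V \<noteq> {}" and "\<And>x. x \<in> V \<Longrightarrow> 0 \<le> N x"
  shows "closedin (bw_star_topology V N) A \<longleftrightarrow> bw_star_closed V N A"
proof -
  have op: "openin (bw_star_topology V N) G \<longleftrightarrow>
      G \<subseteq> cdual V N \<and> bw_star_closed V N (cdual V N - G)" for G
    unfolding bw_star_topology_def
    by (simp add: topology_inverse'[OF istopology_bw_star[OF assms]])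
  have "openin (bw_star_topology V N) (cdual V N)"
    unfolding op by (simp add: bw_star_closed_def)
  moreover have "topspace (bw_star_topology V N) \<subseteq> cdual V N"
    using op openin_topspace by blast
  ultimately have top: "topspace (bw_star_topology V N) = cdual V N"
    by (intro subset_antisym openin_subset)
  have "closedin (bw_star_topology V N) A \<longleftrightarrow>
      A \<subseteq> cdual V N \<and> bw_star_closed V N (cdual V N - (cdual V N - A))"
    unfolding closedin_def top op by blast
  also have "\<dots> \<longleftrightarrow> bw_star_closed V N A"
  proof (cases "A \<subseteq> cdual V N")
    case True
    then show ?thesis by (simp add: double_diff)
  qed (simp add: bw_star_closed_def)
  finally show ?thesis .
qed

end

theory Submission
  imports Defs
begin

text \<open>
  Write b(\<phi>, u) = u(\<phi> \<circ> f) for a functional \<phi> on F and an element u of the dual of the space of bounded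
  holomorphic functions. Every operator in the theorem is one of the two maps that this pairing
  induces: the transpose sends \<phi> to \<phi> \<circ> f, the linearization T sends u to the vector y with
  \<phi>(y) = b(\<phi>, u) for all \<phi>, and f itself is the restriction of T to the evaluations. Norms on both sides
  are suprema of the pairing; on the side of F this is the Hahn-Banach theorem.

  The conditions are connected by a cycle. If the range of f is covered by finitely many small balls,
  then on a bounded set of functionals the size of (\<phi> - \<psi>) \<circ> f is controlled by the values of \<phi> - \<psi> at
  the finitely many centres, so the transpose is weak*-to-norm continuous on bounded sets
  (weak_star_continuous_on_balls); this is exactly bounded-weak*-to-norm continuity
  (bw_star_continuousI). The unit ball of the dual of F is weak*-compact (Banach_Alaoglu), so its image
  under such a transpose is norm compact (compact_op_transpose_if_bw_star_continuous). A pairing that is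
  totally bounded in one variable, uniformly in the other, is totally bounded in the other variable too
  (finite_net_transpose, which is the combinatorial core of Schauder's theorem); hence compactness
  passes from the transpose to T (compact_op_linearization_if_transpose). Finally, f maps into the
  image of the unit ball under T, because evaluations have norm at most one.

  In the last two conditions, bounded-weak*-to-weak continuity follows because the norm topology refines
  the weak one. Weak*-to-weak continuity says that each functional \<phi> \<mapsto> u(\<phi> \<circ> f) is evaluation at a point
  of F, for u in the whole dual and not only in the predual. This is Hinf_dual_represented: the
  functional is small on the annihilator of a finite net of the range, so after subtracting a
  Hahn-Banach extension of this small restriction it vanishes there and is an evaluation; thus it
  is a norm limit of evaluations, and F is complete.

  The Hahn-Banach theorem is proved over the reals, with the Banach space of bounded real functionals
  standing for the complex dual: complexify turns a bounded real functional g into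
  \<phi>(x) = g(x) - i g(ix).
\<close>

section \<open>The Hahn-Banach theorem\<close>

definition sublinear :: "('v::real_vector \<Rightarrow> real) \<Rightarrow> bool"
  where "sublinear p \<longleftrightarrow>
    (\<forall>x y. p (x + y) \<le> p x + p y) \<and> (\<forall>t\<ge>0. \<forall>x. p (t *\<^sub>R x) \<le> t * p x)"

lemma sublinear_add: "sublinear p \<Longrightarrow> p (x + y) \<le> p x + p y"
  by (simp add: sublinear_def)

lemma sublinear_zero:
  assumes "sublinear p"
  shows "p 0 = 0"
proof -
  have "p (0 *\<^sub>R 0) \<le> 0 * p 0"
    using assms unfolding sublinear_def by blast
  moreover have "p (0 + 0) \<le> p 0 + p 0"
    by (rule sublinear_add[OF assms])
  ultimately show ?thesis by simp
qed

lemma sublinear_scaleR: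
  assumes p: "sublinear p" and "0 \<le> t"
  shows "p (t *\<^sub>R x) = t * p x"
proof (cases "t = 0")
  case False
  then have t: "0 < t" using \<open>0 \<le> t\<close> by simp
  have "p (inverse t *\<^sub>R t *\<^sub>R x) \<le> inverse t * p (t *\<^sub>R x)"
    using p t unfolding sublinear_def by (meson inverse_nonnegative_iff_nonnegative order_less_imp_le)
  then have "t * p x \<le> p (t *\<^sub>R x)"
    using t by (simp add: field_simps)
  moreover have "p (t *\<^sub>R x) \<le> t * p x"
    using p \<open>0 \<le> t\<close> by (simp add: sublinear_def)
  ultimately show ?thesis by simp
qed (simp add: sublinear_zero[OF p])

lemma sublinear_minus: "sublinear p \<Longrightarrow> - p (- x) \<le> p x"
  using sublinear_add[of p x "- x"] sublinear_zero[of p] by simp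

text \<open>
The infimum of a family that is only jointly subadditive and homogeneous: the index may change with the
sum and the multiple. Below, the family is a chain, the translations along a ray, or the translations along
a subspace.
\<close>

lemma sublinear_INF:
  fixes b :: "'i \<Rightarrow> 'v::real_vector \<Rightarrow> real"
  assumes ne: "I \<noteq> {}"
    and bdd: "\<And>x. bdd_below ((\<lambda>i. b i x) ` I)"
    and add: "\<And>i j x y. \<lbrakk>i \<in> I; j \<in> I\<rbrakk> \<Longrightarrow> \<exists>k\<in>I. b k (x + y) \<le> b i x + b j y"
    and scale: "\<And>i t x. \<lbrakk>i \<in> I; 0 \<le> t\<rbrakk> \<Longrightarrow> \<exists>k\<in>I. b k (t *\<^sub>R x) \<le> t * b i x"
  shows "sublinear (\<lambda>x. INF i\<in>I. b i x)"
  unfolding sublinear_def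
proof (intro conjI allI impI)
  fix x y
  have step: "(INF k\<in>I. b k (x + y)) - b j y \<le> (INF i\<in>I. b i x)" if j: "j \<in> I" for j
  proof (rule cINF_greatest[OF ne])
    fix i assume "i \<in> I"
    with add[OF this j, of x y] obtain k where "k \<in> I" "b k (x + y) \<le> b i x + b j y" by blast
    then show "(INF k\<in>I. b k (x + y)) - b j y \<le> b i x"
      using cINF_lower[OF bdd, of k "x + y"] by linarith
  qed
  have "(INF k\<in>I. b k (x + y)) - (INF i\<in>I. b i x) \<le> (INF j\<in>I. b j y)"
    by (rule cINF_greatest[OF ne]) (use step in force)
  then show "(INF k\<in>I. b k (x + y)) \<le> (INF i\<in>I. b i x) + (INF j\<in>I. b j y)"
    by linarith
next
  fix t :: real and x assume t: "0 \<le> t"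
  have le: "(INF k\<in>I. b k (t *\<^sub>R x)) \<le> t * b i x" if i: "i \<in> I" for i
  proof -
    obtain k where "k \<in> I" "b k (t *\<^sub>R x) \<le> t * b i x" using scale[OF i t] by blast
    then show ?thesis using cINF_lower[OF bdd, of k "t *\<^sub>R x"] by linarith
  qed
  show "(INF k\<in>I. b k (t *\<^sub>R x)) \<le> t * (INF i\<in>I. b i x)"
  proof (cases "t = 0")
    case True
    then show ?thesis using le ne by fastforce
  next
    case False
    then have "0 < t" using t by simp
    have "(INF k\<in>I. b k (t *\<^sub>R x)) / t \<le> (INF i\<in>I. b i x)"
      by (rule cINF_greatest[OF ne]) (use le \<open>0 < t\<close> in \<open>simp add: divide_simps mult.commute\<close>)
    then show ?thesis using \<open>0 < t\<close> by (simp add: divide_simps mult.commute)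
  qed
qed

text \<open>
Zorn's lemma for the reversed pointwise order: a chain has its pointwise infimum as a bound, which is
finite because every sublinear q below p satisfies q x \<ge> - q (- x) \<ge> - p (- x).
\<close>

lemma minimal_sublinear:
  fixes p :: "'v::real_vector \<Rightarrow> real"
  assumes p: "sublinear p"
  obtains m where "sublinear m" "m \<le> p" "\<And>q. \<lbrakk>sublinear q; q \<le> m\<rbrakk> \<Longrightarrow> q = m"
proof -
  let ?A = "{q. sublinear q \<and> q \<le> p}"
  have "\<exists>m\<in>?A. \<forall>q\<in>?A. q \<le> m \<longrightarrow> q = m"
  proof (rule predicate_Zorn)
    show "partial_order_on ?A (relation_of (\<lambda>q r. r \<le> q) ?A)"
      by (auto simp: partial_order_on_def preorder_on_def refl_on_def trans_def antisym_def
          relation_of_def)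
    fix C assume "C \<in> Chains (relation_of (\<lambda>q r. r \<le> q) ?A)"
    then have C: "\<And>q. q \<in> C \<Longrightarrow> sublinear q" "\<And>q. q \<in> C \<Longrightarrow> q \<le> p"
      and chain: "\<And>q r. \<lbrakk>q \<in> C; r \<in> C\<rbrakk> \<Longrightarrow> q \<le> r \<or> r \<le> q"
      by (auto simp: Chains_def relation_of_def)
    show "\<exists>u\<in>?A. \<forall>q\<in>C. u \<le> q"
    proof (cases "C = {}")
      case True
      with p show ?thesis by (intro bexI[of _ p]) auto
    next
      case False
      define u where "u = (\<lambda>x. INF q\<in>C. q x)"
      have bdd: "bdd_below ((\<lambda>q. q x) ` C)" for x
      proof (rule bdd_belowI2)
        fix q assume "q \<in> C"
        then show "- p (- x) \<le> q x"
          using sublinear_minus[OF C(1), of q x] C(2)[of q] le_funD[of q p "- x"] by force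
      qed
      have le: "u \<le> q" if "q \<in> C" for q
        unfolding u_def le_fun_def using cINF_lower[OF bdd that] by simp
      have "sublinear u"
        unfolding u_def
      proof (rule sublinear_INF[OF False bdd])
        fix q r :: "'v \<Rightarrow> real" and x y assume qr: "q \<in> C" "r \<in> C"
        from chain[OF qr] show "\<exists>k\<in>C. k (x + y) \<le> q x + r y"
        proof
          assume "q \<le> r"
          with sublinear_add[OF C(1)[OF qr(1)], of x y] qr show ?thesis
            by (intro bexI[of _ q]) (auto simp: le_fun_def intro: order_trans)
        next
          assume "r \<le> q"
          with sublinear_add[OF C(1)[OF qr(2)], of x y] qr show ?thesis
            by (intro bexI[of _ r]) (auto simp: le_fun_def intro: order_trans)
        qed
      next
        fix q :: "'v \<Rightarrow> real" and x and t :: real assume "q \<in> C" "0 \<le> t"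
        then show "\<exists>k\<in>C. k (t *\<^sub>R x) \<le> t * q x"
          by (intro bexI[of _ q]) (simp add: sublinear_scaleR[OF C(1)])
      qed
      moreover have "u \<le> p"
        using False le C(2) order_trans by blast
      ultimately show ?thesis using le by blast
    qed
  qed
  then show ?thesis using that order_trans by blast
qed

text \<open>
For fixed y, the functional x \<mapsto> inf over t \<ge> 0 of m (x + t y) - t m y is sublinear and at most m, so it equals m
by minimality; its value at t = 1 then bounds m x from above by m (x + y) - m y.
\<close>

lemma minimal_sublinear_imp_linear:
  fixes m :: "'v::real_vector \<Rightarrow> real"
  assumes m: "sublinear m" and min: "\<And>q. \<lbrakk>sublinear q; q \<le> m\<rbrakk> \<Longrightarrow> q = m"
  shows "linear m"
proof -
  have superadd: "m x + m y \<le> m (x + y)" for x y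
  proof -
    define b where "b = (\<lambda>t x. m (x + t *\<^sub>R y) - t * m y)"
    have bdd: "bdd_below ((\<lambda>t. b t x) ` {0..})" for x
    proof (rule bdd_belowI2)
      fix t :: real assume "t \<in> {0..}"
      then have "t * m y \<le> m (x + t *\<^sub>R y) + m (- x)"
        using sublinear_add[OF m, of "x + t *\<^sub>R y" "- x"] sublinear_scaleR[OF m, of t y] by simp
      then show "- m (- x) \<le> b t x" by (simp add: b_def)
    qed
    have "sublinear (\<lambda>x. INF t\<in>{0..}. b t x)"
    proof (rule sublinear_INF[OF _ bdd])
      fix s t :: real and x z assume "s \<in> {0..}" "t \<in> {0..}"
      then show "\<exists>k\<in>{0..}. b k (x + z) \<le> b s x + b t z"
        using sublinear_add[OF m, of "x + s *\<^sub>R y" "z + t *\<^sub>R y"]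
        by (intro bexI[of _ "s + t"]) (auto simp: b_def algebra_simps)
    next
      fix s t :: real and x assume "s \<in> {0..}" "0 \<le> t"
      then show "\<exists>k\<in>{0..}. b k (t *\<^sub>R x) \<le> t * b s x"
        using sublinear_scaleR[OF m, of t "x + s *\<^sub>R y"]
        by (intro bexI[of _ "t * s"]) (auto simp: b_def algebra_simps)
    qed simp
    moreover have "(\<lambda>x. INF t\<in>{0..}. b t x) \<le> m"
      using cINF_lower[OF bdd, of 0] by (simp add: b_def le_fun_def)
    ultimately have "(\<lambda>x. INF t\<in>{0..}. b t x) = m" by (rule min)
    then have "m x = (INF t\<in>{0..}. b t x)" by metis
    also have "\<dots> \<le> b 1 x" by (rule cINF_lower[OF bdd]) simp
    finally show ?thesis by (simp add: b_def)
  qed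
  have add: "m (x + y) = m x + m y" for x y
    using superadd sublinear_add[OF m] by (simp add: order_antisym)
  have neg: "m (- x) = - m x" for x
    using add[of x "- x"] sublinear_zero[OF m] by simp
  show ?thesis
  proof (rule linearI[OF add])
    fix r x show "m (r *\<^sub>R x) = r *\<^sub>R m x"
      using sublinear_scaleR[OF m, of r x] sublinear_scaleR[OF m, of "- r" x] neg[of "r *\<^sub>R x"]
      by (cases "0 \<le> r") auto
  qed
qed

text \<open>
The functional to be extended is a linear functional on the whole space of which only the restriction to W
is dominated by p. A minimal sublinear functional below x \<mapsto> inf over w \<in> W of \<psi> w + p (x - w) is linear, and on
W it is at most \<psi>, hence equal to \<psi>, since W is closed under negation.
\<close>

theorem Hahn_Banach_sublinear:
  fixes p \<psi> :: "'v::real_vector \<Rightarrow> real"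
  assumes p: "sublinear p" and W: "subspace W" and \<psi>: "linear \<psi>"
    and le: "\<And>w. w \<in> W \<Longrightarrow> \<psi> w \<le> p w"
  obtains h where "linear h" "\<And>w. w \<in> W \<Longrightarrow> h w = \<psi> w" "\<And>x. h x \<le> p x"
proof -
  define b where "b = (\<lambda>w x. \<psi> w + p (x - w))"
  have bdd: "bdd_below ((\<lambda>w. b w x) ` W)" for x
  proof (rule bdd_belowI2)
    fix w assume "w \<in> W"
    then have "- \<psi> w \<le> p (- w)"
      using le[of "- w"] W by (simp add: linear_neg[OF \<psi>] subspace_neg)
    also have "\<dots> \<le> p (x - w) + p (- x)"
      using sublinear_add[OF p, of "x - w" "- x"] by simp
    finally show "- p (- x) \<le> b w x" by (simp add: b_def)
  qed
  have ne: "0 \<in> W" by (rule subspace_0[OF W])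
  have "sublinear (\<lambda>x. INF w\<in>W. b w x)"
  proof (rule sublinear_INF[OF _ bdd])
    fix v w x y assume "v \<in> W" "w \<in> W"
    then show "\<exists>k\<in>W. b k (x + y) \<le> b v x + b w y"
      using sublinear_add[OF p, of "x - v" "y - w"]
      by (intro bexI[of _ "v + w"]) (auto simp: b_def linear_add[OF \<psi>] subspace_add[OF W] algebra_simps)
  next
    fix w x and t :: real assume "w \<in> W" "0 \<le> t"
    then show "\<exists>k\<in>W. b k (t *\<^sub>R x) \<le> t * b w x"
      using sublinear_scaleR[OF p, of t "x - w"]
      by (intro bexI[of _ "t *\<^sub>R w"])
        (auto simp: b_def linear_scale[OF \<psi>] subspace_scale[OF W] algebra_simps)
  qed (use ne in blast)
  then obtain h where lin: "linear h" and h: "h \<le> (\<lambda>x. INF w\<in>W. b w x)"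
    by (rule minimal_sublinear) (use minimal_sublinear_imp_linear in blast)
  have hb: "h x \<le> b w x" if "w \<in> W" for w x
    using le_funD[OF h, of x] cINF_lower[OF bdd that, of x] by simp
  have hW: "h w \<le> \<psi> w" if "w \<in> W" for w
    using hb[OF that, of w] by (simp add: b_def sublinear_zero[OF p])
  show ?thesis
  proof
    show "linear h" by (rule lin)
    show "h x \<le> p x" for x
      using hb[OF ne, of x] by (simp add: b_def linear_0[OF \<psi>])
    show "h w = \<psi> w" if "w \<in> W" for w
      using hW[OF that] hW[of "- w"] that W
      by (simp add: linear_neg[OF \<psi>] linear_neg[OF lin] subspace_neg)
  qed
qed

section \<open>Duals of normed spaces given by a carrier\<close>

text \<open>
What the passage from a bound on the unit ball to a bound by the norm uses: vectors can be rescaled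
inside the carrier.
\<close>

definition homogeneous_on :: "'v::complex_vector set \<Rightarrow> ('v \<Rightarrow> real) \<Rightarrow> bool"
  where "homogeneous_on V N \<longleftrightarrow> (\<forall>x\<in>V. 0 \<le> N x) \<and>
    (\<forall>a. \<forall>x\<in>V. a *\<^sub>C x \<in> V \<and> N (a *\<^sub>C x) = cmod a * N x)"

lemma homogeneous_onD:
  assumes "homogeneous_on V N" "x \<in> V"
  shows "0 \<le> N x" "a *\<^sub>C x \<in> V" "N (a *\<^sub>C x) = cmod a * N x"
  using assms by (auto simp: homogeneous_on_def)

lemma homogeneous_on_norm: "homogeneous_on UNIV (norm :: 'f::complex_normed_vector \<Rightarrow> real)"
  by (simp add: homogeneous_on_def norm_scaleC)

text \<open>
Vectors of norm zero cannot be normalized, so a vector x is rescaled by a number slightly larger than its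
norm.
\<close>

lemma cball_cdual_iff:
  assumes V: "homogeneous_on V N"
    and t: "0 \<le> t"
  shows "\<phi> \<in> cball_on (cdual V N) (cdual_norm V N) t \<longleftrightarrow>
    \<phi> \<in> cdual V N \<and> (\<forall>x\<in>V. cmod (\<phi> x) \<le> t * N x)"
proof (cases "\<phi> \<in> cdual V N")
  case True
  have "cdual_norm V N \<phi> \<le> t \<longleftrightarrow> (\<forall>x\<in>cball_on V N 1. cmod (\<phi> x) \<le> t)"
    unfolding cdual_norm_def by (rule sup_norm_le_iff[OF bounded_cdual[OF homogeneous_onD(1)[OF V] True] t])
  also have "\<dots> \<longleftrightarrow> (\<forall>x\<in>V. cmod (\<phi> x) \<le> t * N x)"
  proof (intro iffI ballI)
    fix x assume *: "\<forall>x\<in>cball_on V N 1. cmod (\<phi> x) \<le> t" and x: "x \<in> V"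
    show "cmod (\<phi> x) \<le> t * N x"
    proof (rule field_le_epsilon)
      fix e :: real assume e: "0 < e"
      define s where "s = N x + e / (t + 1)"
      have s: "0 < s" "N x \<le> s"
        using homogeneous_onD(1)[OF V x] e t by (auto simp: s_def add_nonneg_pos)
      have "complex_of_real (1 / s) *\<^sub>C x \<in> cball_on V N 1"
        using homogeneous_onD(2,3)[OF V x, of "complex_of_real (1 / s)"] s by (simp add: cball_on_def norm_divide)
      with * have "cmod (\<phi> (complex_of_real (1 / s) *\<^sub>C x)) \<le> t" by blast
      moreover have "\<phi> (complex_of_real (1 / s) *\<^sub>C x) = complex_of_real (1 / s) * \<phi> x"
        using True x unfolding cdual_def bounded_op_def scaleC_complex_def by blast
      ultimately have "cmod (\<phi> x) / s \<le> t"
        using s by (simp add: norm_mult norm_divide)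
      then have "cmod (\<phi> x) \<le> t * s"
        using s by (simp add: pos_divide_le_eq)
      also have "\<dots> = t * N x + e * (t / (t + 1))"
        by (simp add: s_def algebra_simps)
      also have "\<dots> \<le> t * N x + e"
        using e t by (intro add_left_mono mult_left_le) auto
      finally show "cmod (\<phi> x) \<le> t * N x + e" .
    qed
  next
    fix x assume *: "\<forall>x\<in>V. cmod (\<phi> x) \<le> t * N x" and x: "x \<in> cball_on V N 1"
    then have "cmod (\<phi> x) \<le> t * N x" "t * N x \<le> t * 1"
      using mult_left_mono[of "N x" 1 t] t by (auto simp: cball_on_def)
    then show "cmod (\<phi> x) \<le> t" by simp
  qed
  finally show ?thesis using True by (simp add: cball_on_def)
qed (simp add: cball_on_def)

lemma cdual_norm_nonneg:
  assumes V: "homogeneous_on V N" and \<phi>: "\<phi> \<in> cdual V N"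
  shows "0 \<le> cdual_norm V N \<phi>"
  unfolding cdual_norm_def
  by (rule sup_norm_nonneg[OF bounded_cdual[OF homogeneous_onD(1)[OF V] \<phi>]])

lemma cdual_bound:
  assumes V: "homogeneous_on V N" and \<phi>: "\<phi> \<in> cdual V N" and "x \<in> V"
  shows "cmod (\<phi> x) \<le> cdual_norm V N \<phi> * N x"
proof -
  have "\<phi> \<in> cball_on (cdual V N) (cdual_norm V N) (cdual_norm V N \<phi>)"
    using \<phi> by (simp add: cball_on_def)
  then show ?thesis
    using cball_cdual_iff[OF V cdual_norm_nonneg[OF V \<phi>]] \<open>x \<in> V\<close> by blast
qed

lemma cdual_add:
  assumes "\<phi> \<in> cdual V N" "\<psi> \<in> cdual V N"
  shows "\<phi> + \<psi> \<in> cdual V N"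
proof -
  obtain K where K: "\<And>x. x \<in> V \<Longrightarrow> cmod (\<phi> x) \<le> K * N x"
    using assms(1) unfolding cdual_def bounded_op_def by blast
  obtain L where L: "\<And>x. x \<in> V \<Longrightarrow> cmod (\<psi> x) \<le> L * N x"
    using assms(2) unfolding cdual_def bounded_op_def by blast
  have "cmod (\<phi> x + \<psi> x) \<le> (K + L) * N x" if "x \<in> V" for x
    using K[OF that] L[OF that] norm_triangle_ineq[of "\<phi> x" "\<psi> x"] by (simp add: algebra_simps)
  then have "\<exists>K. \<forall>x\<in>V. cmod (\<phi> x + \<psi> x) \<le> K * N x" by blast
  then show ?thesis
    using assms by (simp add: cdual_def bounded_op_def scaleC_complex_def distrib_left)
qed

lemma cdual_scaleC:
  assumes "\<phi> \<in> cdual V N"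
  shows "a *\<^sub>C \<phi> \<in> cdual V N"
proof -
  obtain K where K: "\<And>x. x \<in> V \<Longrightarrow> cmod (\<phi> x) \<le> K * N x"
    using assms unfolding cdual_def bounded_op_def by blast
  have "cmod (a * \<phi> x) \<le> (cmod a * K) * N x" if "x \<in> V" for x
    using mult_left_mono[OF K[OF that], of "cmod a"] by (simp add: norm_mult mult.assoc)
  then have "\<exists>K. \<forall>x\<in>V. cmod (a * \<phi> x) \<le> K * N x" by blast
  then show ?thesis
    using assms by (simp add: cdual_def bounded_op_def scaleC_complex_def scaleC_fun_def distrib_left)
qed

lemma cdual_diff:
  assumes "\<phi> \<in> cdual V N" "\<psi> \<in> cdual V N"
  shows "\<phi> - \<psi> \<in> cdual V N"
proof -
  have "\<phi> + (- 1) *\<^sub>C \<psi> = \<phi> - \<psi>" by (simp add: fun_eq_iff scaleC_fun_def scaleC_complex_def)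
  with cdual_add[OF assms(1) cdual_scaleC[OF assms(2), of "- 1"]] show ?thesis by simp
qed

lemma cdual_norm_add:
  assumes V: "homogeneous_on V N"
    and \<phi>: "\<phi> \<in> cdual V N" and \<psi>: "\<psi> \<in> cdual V N"
  shows "cdual_norm V N (\<phi> + \<psi>) \<le> cdual_norm V N \<phi> + cdual_norm V N \<psi>"
proof -
  let ?t = "cdual_norm V N \<phi> + cdual_norm V N \<psi>"
  have "0 \<le> ?t" using cdual_norm_nonneg[OF V \<phi>] cdual_norm_nonneg[OF V \<psi>] by (simp add: add_nonneg_nonneg)
  moreover have "cmod ((\<phi> + \<psi>) x) \<le> ?t * N x" if "x \<in> V" for x
    using cdual_bound[OF V \<phi> that] cdual_bound[OF V \<psi> that]
      norm_triangle_ineq[of "\<phi> x" "\<psi> x"] by (simp add: algebra_simps)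
  ultimately have "\<phi> + \<psi> \<in> cball_on (cdual V N) (cdual_norm V N) ?t"
    using cdual_add[OF \<phi> \<psi>] by (simp add: cball_cdual_iff[OF V])
  then show ?thesis by (simp add: cball_on_def)
qed

lemma cdual_norm_scaleC_le:
  assumes V: "homogeneous_on V N"
    and \<phi>: "\<phi> \<in> cdual V N"
  shows "cdual_norm V N (a *\<^sub>C \<phi>) \<le> cmod a * cdual_norm V N \<phi>"
proof -
  let ?t = "cmod a * cdual_norm V N \<phi>"
  have "0 \<le> ?t" using cdual_norm_nonneg[OF V \<phi>] by simp
  moreover have "cmod ((a *\<^sub>C \<phi>) x) \<le> ?t * N x" if "x \<in> V" for x
    using mult_left_mono[OF cdual_bound[OF V \<phi> that], of "cmod a"]
    by (simp add: scaleC_fun_def scaleC_complex_def norm_mult mult.assoc)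
  ultimately have "a *\<^sub>C \<phi> \<in> cball_on (cdual V N) (cdual_norm V N) ?t"
    using cdual_scaleC[OF \<phi>] by (simp add: cball_cdual_iff[OF V])
  then show ?thesis by (simp add: cball_on_def)
qed

interpretation complex_space: vector_space "scaleC :: complex \<Rightarrow> 'v \<Rightarrow> 'v::complex_vector"
  by (rule vector_space_scaleC)

lemma subspace_cdual: "complex_space.subspace (cdual V N)"
  by (rule complex_space.subspaceI)
    (use cdual_zero cdual_add cdual_scaleC in \<open>auto simp: zero_fun_def\<close>)

lemma bounded_op_bound:
  assumes "bounded_op V N W M T"
  obtains K where "\<And>x. x \<in> V \<Longrightarrow> M (T x) \<le> K * N x"
proof -
  have "\<exists>K. \<forall>x\<in>V. M (T x) \<le> K * N x" using assms by (simp add: bounded_op_def)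
  then show ?thesis using that by blast
qed

section \<open>Real and complex functionals on a Banach space\<close>

abbreviation dual_ball :: "real \<Rightarrow> ('f::complex_normed_vector \<Rightarrow> complex) set"
  where "dual_ball t \<equiv> cball_on (cdual UNIV norm) (cdual_norm UNIV norm) t"

lemma cdual_UNIV_iff:
  "\<phi> \<in> cdual UNIV norm \<longleftrightarrow> (\<forall>x y. \<phi> (x + y) = \<phi> x + \<phi> y) \<and> (\<forall>a x. \<phi> (a *\<^sub>C x) = a * \<phi> x) \<and>
    (\<exists>K. \<forall>x. cmod (\<phi> x) \<le> K * norm x)"
  by (simp add: cdual_def bounded_op_def scaleC_complex_def)

lemma dual_ball_iff:
  assumes "0 \<le> t"
  shows "\<phi> \<in> dual_ball t \<longleftrightarrow> \<phi> \<in> cdual UNIV norm \<and> (\<forall>x. cmod (\<phi> x) \<le> t * norm x)"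
  unfolding cball_cdual_iff[OF homogeneous_on_norm assms] ball_UNIV ..

lemma cdual_UNIV_bounded_linear:
  fixes \<phi> :: "'f::complex_normed_vector \<Rightarrow> complex"
  assumes "\<phi> \<in> cdual UNIV norm"
  shows "bounded_linear \<phi>"
proof -
  have add: "\<And>x y. \<phi> (x + y) = \<phi> x + \<phi> y" and sc: "\<And>a x. \<phi> (a *\<^sub>C x) = a * \<phi> x"
    using assms by (auto simp: cdual_UNIV_iff)
  obtain K where K: "\<And>x. cmod (\<phi> x) \<le> K * norm x"
    using assms by (auto simp: cdual_UNIV_iff)
  show ?thesis
  proof (rule bounded_linear_intro[OF add])
    show "\<phi> (r *\<^sub>R x) = r *\<^sub>R \<phi> x" for r x
      by (simp only: scaleR_scaleC sc) (simp add: scaleC_complex_def)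
    show "norm (\<phi> x) \<le> norm x * K" for x using K[of x] by (simp add: mult.commute)
  qed
qed

lemma dual_ball_linear: "\<phi> \<in> dual_ball t \<Longrightarrow> linear \<phi>"
  by (rule bounded_linear.linear[OF cdual_UNIV_bounded_linear]) (simp add: cball_on_def)

lemma cdual_in_dual_ball:
  fixes \<phi> :: "'f::complex_normed_vector \<Rightarrow> complex"
  assumes "\<phi> \<in> cdual UNIV norm"
  obtains t where "0 < t" "\<phi> \<in> dual_ball t"
proof -
  obtain K where K: "\<And>x. cmod (\<phi> x) \<le> K * norm x"
    using assms by (auto simp: cdual_UNIV_iff)
  have "\<phi> \<in> dual_ball (\<bar>K\<bar> + 1)"
    unfolding dual_ball_iff[of "\<bar>K\<bar> + 1" \<phi>, simplified]
  proof (intro conjI allI assms)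
    show "cmod (\<phi> x) \<le> (\<bar>K\<bar> + 1) * norm x" for x
      using K[of x] mult_right_mono[of K "\<bar>K\<bar> + 1" "norm x", OF _ norm_ge_zero] by linarith
  qed
  then show ?thesis using that[of "\<bar>K\<bar> + 1"] by simp
qed

lemma dual_ball_scaleC:
  assumes t: "0 \<le> t" and \<phi>: "\<phi> \<in> dual_ball t"
  shows "a *\<^sub>C \<phi> \<in> dual_ball (cmod a * t)"
proof -
  have "cmod ((a *\<^sub>C \<phi>) x) \<le> cmod a * t * norm x" for x
    using \<phi> mult_left_mono[of "cmod (\<phi> x)" "t * norm x" "cmod a"]
    by (simp add: dual_ball_iff[OF t] scaleC_fun_def scaleC_complex_def norm_mult mult.assoc)
  moreover have "a *\<^sub>C \<phi> \<in> cdual UNIV norm"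
    using \<phi> by (intro cdual_scaleC) (simp add: cball_on_def)
  ultimately show ?thesis using t by (simp add: dual_ball_iff)
qed

text \<open>
The complex functional with real part g; its imaginary part at x is forced to be - g (i x).
\<close>

definition complexify :: "('f::complex_normed_vector \<Rightarrow>\<^sub>L real) \<Rightarrow> 'f \<Rightarrow> complex"
  where "complexify g x = Complex (g x) (- g (\<i> *\<^sub>C x))"

lemma complexify_bound:
  fixes g :: "'f::complex_normed_vector \<Rightarrow>\<^sub>L real"
  shows complexify_cdual: "complexify g \<in> cdual UNIV norm"
    and complexify_dual_ball: "complexify g \<in> dual_ball (norm g)"
proof -
  have add: "complexify g (x + y) = complexify g x + complexify g y" for x y
    by (simp add: complexify_def scaleC_add_right blinfun.add_right complex_eq_iff)
  have sc: "complexify g (a *\<^sub>C x) = a * complexify g x" for a x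
  proof -
    have eq: "b *\<^sub>C x = Re b *\<^sub>R x + Im b *\<^sub>R \<i> *\<^sub>C x" for b
    proof -
      have "b = complex_of_real (Re b) + complex_of_real (Im b) * \<i>"
        by (simp add: complex_eq_iff)
      then have "b *\<^sub>C x = (complex_of_real (Re b) + complex_of_real (Im b) * \<i>) *\<^sub>C x"
        by (rule arg_cong)
      then show ?thesis by (simp only: scaleC_add_left scaleC_scaleC scaleR_scaleC)
    qed
    have gb: "g (b *\<^sub>C x) = Re b * g x + Im b * g (\<i> *\<^sub>C x)" for b
      by (subst eq) (simp add: blinfun.add_right blinfun.scaleR_right)
    show ?thesis
      by (simp add: complexify_def scaleC_scaleC gb[of a] gb[of "\<i> * a"] complex_eq_iff)
  qed
  have bd: "cmod (complexify g x) \<le> norm g * norm x" for x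
  proof (cases "complexify g x = 0")
    case False
    \<comment> \<open>A unimodular multiple of x has the same norm, and there the value is real and equal to that of g.\<close>
    define c where "c = cnj (sgn (complexify g x))"
    have c: "cmod c = 1" using False by (simp add: c_def norm_sgn)
    have "c * complexify g x = complex_of_real (cmod (complexify g x))"
      using complex_norm_square[of "complexify g x"] False
      by (simp add: c_def sgn_eq field_simps power2_eq_square)
    then have "complexify g (c *\<^sub>C x) = complex_of_real (cmod (complexify g x))"
      by (simp add: sc)
    then have "cmod (complexify g x) = g (c *\<^sub>C x)"
      by (simp add: complexify_def complex_eq_iff)
    also have "\<dots> \<le> norm g * norm (c *\<^sub>C x)"
      using norm_blinfun[of g "c *\<^sub>C x"] by simp
    finally show ?thesis by (simp add: norm_scaleC c)
  qed simp
  show "complexify g \<in> cdual UNIV norm"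
    unfolding cdual_UNIV_iff using add sc bd by blast
  then show "complexify g \<in> dual_ball (norm g)"
    using bd by (simp add: dual_ball_iff)
qed

lemma complexify_add: "complexify (g + h) = complexify g + complexify h"
  by (simp add: fun_eq_iff complexify_def blinfun.add_left complex_eq_iff)

lemma complexify_scaleR: "complexify (r *\<^sub>R g) = complex_of_real r *\<^sub>C complexify g"
  by (simp add: fun_eq_iff complexify_def blinfun.scaleR_left scaleC_fun_def scaleC_complex_def complex_eq_iff)

lemma dual_ball_complexify:
  fixes \<phi> :: "'f::complex_normed_vector \<Rightarrow> complex"
  assumes t: "0 \<le> t" and \<phi>: "\<phi> \<in> dual_ball t"
  obtains g where "complexify g = \<phi>" "norm g \<le> t" "\<And>x. blinfun_apply g x = Re (\<phi> x)"
proof -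
  have \<phi>D: "\<phi> \<in> cdual UNIV norm" "\<And>x. cmod (\<phi> x) \<le> t * norm x"
    using \<phi> t by (auto simp: dual_ball_iff)
  have bl: "bounded_linear (\<lambda>x. Re (\<phi> x))"
    using cdual_UNIV_bounded_linear[OF \<phi>D(1)] by (rule bounded_linear_compose[OF bounded_linear_Re])
  define g where "g = Blinfun (\<lambda>x. Re (\<phi> x))"
  have g: "blinfun_apply g x = Re (\<phi> x)" for x
    by (simp add: g_def bounded_linear_Blinfun_apply[OF bl])
  have "complexify g = \<phi>"
    using \<phi>D(1) by (auto simp: fun_eq_iff complexify_def g complex_eq_iff cdual_UNIV_iff)
  moreover have "norm g \<le> t"
    by (rule norm_blinfun_bound[OF t])
      (use \<phi>D(2) abs_Re_le_cmod order_trans in \<open>fastforce simp: g\<close>)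
  ultimately show ?thesis using g that by blast
qed

lemma sublinear_norm:
  assumes "0 \<le> c"
  shows "sublinear (\<lambda>x::'v::real_normed_vector. c * norm x)"
  unfolding sublinear_def
proof (intro conjI allI impI)
  show "c * norm (x + y) \<le> c * norm x + c * norm y" for x y :: 'v
    using mult_left_mono[OF norm_triangle_ineq[of x y] assms] by (simp add: distrib_left)
qed simp

text \<open>
The norm of F is the supremum of the unit ball of its dual: the Hahn-Banach theorem extends the functional
r y \<mapsto> r * norm y from the line through y.
\<close>

lemma norming_functional:
  fixes y :: "'f::complex_normed_vector"
  obtains \<phi> where "\<phi> \<in> dual_ball 1" "norm y \<le> cmod (\<phi> y)"
proof (cases "y = 0")
  case True
  then show ?thesis
    using that[of "\<lambda>_. 0"] cdual_zero[of UNIV norm] by (simp add: dual_ball_iff)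
next
  case False
  then obtain \<psi> :: "'f \<Rightarrow> real" where \<psi>: "linear \<psi>" "\<psi> y = norm y"
    using linear_independent_extend[of "{y}" "\<lambda>_. norm y"] by auto
  have "\<psi> w \<le> 1 * norm w" if w: "w \<in> span {y}" for w
  proof -
    obtain r where "w = r *\<^sub>R y" using w by (auto simp: span_singleton)
    then show ?thesis
      using \<psi> by (simp add: linear_scale abs_mult_pos mult_right_mono)
  qed
  then obtain h where h: "linear h" "h y = norm y" "\<And>x. h x \<le> 1 * norm x"
    using Hahn_Banach_sublinear[OF sublinear_norm[of 1] subspace_span[of "{y}"] \<psi>(1)] \<psi>(2)
      span_base[of y "{y}"] by (metis insertI1 zero_le_one)
  have habs: "norm (h x) \<le> norm x" for x
    using h(3)[of x] h(3)[of "- x"] by (simp add: linear_neg[OF h(1)] abs_le_iff)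
  have bl: "bounded_linear h"
    by (rule bounded_linear_intro[where K = 1])
      (use habs h(1) in \<open>simp_all add: linear_add linear_scale\<close>)
  define g where "g = Blinfun h"
  have g: "blinfun_apply g x = h x" for x
    by (simp add: g_def bounded_linear_Blinfun_apply[OF bl])
  have "norm g \<le> 1"
    by (rule norm_blinfun_bound) (use habs in \<open>simp_all add: g\<close>)
  then have "complexify g \<in> dual_ball 1"
    using complexify_dual_ball[of g] by (simp add: cball_on_def)
  moreover have "norm y \<le> cmod (complexify g y)"
    using abs_Re_le_cmod[of "complexify g y"] by (simp add: complexify_def g h(2))
  ultimately show ?thesis by (rule that)
qed

lemma norm_le_dual_ball:
  fixes y :: "'f::complex_normed_vector"
  assumes "\<And>\<phi>. \<phi> \<in> dual_ball 1 \<Longrightarrow> cmod (\<phi> y) \<le> c"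
  shows "norm y \<le> c"
proof (rule norming_functional[of y])
  fix \<phi> :: "'f \<Rightarrow> complex" assume "\<phi> \<in> dual_ball 1" "norm y \<le> cmod (\<phi> y)"
  then show ?thesis using assms by (blast intro: order_trans)
qed

lemma dual_ball_separates:
  fixes y z :: "'f::complex_normed_vector"
  assumes "\<And>\<phi>. \<phi> \<in> dual_ball 1 \<Longrightarrow> \<phi> y = \<phi> z"
  shows "y = z"
proof -
  have "norm (y - z) \<le> 0"
    by (rule norm_le_dual_ball) (simp add: linear_diff[OF dual_ball_linear] assms)
  then show ?thesis by simp
qed

text \<open>
F is complete, hence closed in its bidual: approximating vectors for the accuracies 1 / (n + 1) form a
Cauchy sequence because the dual unit ball computes norms.
\<close>

lemma representable_if_approximable:
  fixes \<Phi> :: "('f::complex_banach \<Rightarrow> complex) \<Rightarrow> complex"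
  assumes "\<And>e. 0 < e \<Longrightarrow> \<exists>y. \<forall>\<phi>\<in>dual_ball 1. cmod (\<Phi> \<phi> - \<phi> y) \<le> e"
  shows "\<exists>y. \<forall>\<phi>\<in>dual_ball 1. \<Phi> \<phi> = \<phi> y"
proof -
  have "\<forall>n. \<exists>y. \<forall>\<phi>\<in>dual_ball 1. cmod (\<Phi> \<phi> - \<phi> y) \<le> inverse (real (Suc n))"
    using assms by simp
  then obtain Y where Y: "\<And>n \<phi>. \<phi> \<in> dual_ball 1 \<Longrightarrow> cmod (\<Phi> \<phi> - \<phi> (Y n)) \<le> inverse (real (Suc n))"
    by metis
  have dist: "norm (Y m - Y n) \<le> inverse (real (Suc m)) + inverse (real (Suc n))" for m n
  proof (rule norm_le_dual_ball)
    fix \<phi> :: "'f \<Rightarrow> complex" assume \<phi>: "\<phi> \<in> dual_ball 1"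
    then have "\<phi> (Y m - Y n) = (\<Phi> \<phi> - \<phi> (Y n)) - (\<Phi> \<phi> - \<phi> (Y m))"
      by (simp add: linear_diff[OF dual_ball_linear])
    then show "cmod (\<phi> (Y m - Y n)) \<le> inverse (real (Suc m)) + inverse (real (Suc n))"
      using Y[OF \<phi>, of m] Y[OF \<phi>, of n] norm_triangle_ineq4[of "\<Phi> \<phi> - \<phi> (Y n)" "\<Phi> \<phi> - \<phi> (Y m)"]
      by simp
  qed
  have "Cauchy Y"
  proof (rule CauchyI)
    fix e :: real assume "0 < e"
    then obtain M where M: "inverse (real (Suc M)) < e / 2"
      using reals_Archimedean[of "e / 2"] by auto
    have "norm (Y m - Y n) < e" if "M \<le> m" "M \<le> n" for m n
    proof -
      have "inverse (real (Suc m)) \<le> inverse (real (Suc M))" "inverse (real (Suc n)) \<le> inverse (real (Suc M))"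
        using that by auto
      then show ?thesis using dist[of m n] M by linarith
    qed
    then show "\<exists>M. \<forall>m\<ge>M. \<forall>n\<ge>M. norm (Y m - Y n) < e" by blast
  qed
  then obtain y where y: "Y \<longlonglongrightarrow> y"
    using Cauchy_convergent convergent_def by blast
  have "\<Phi> \<phi> = \<phi> y" if \<phi>: "\<phi> \<in> dual_ball 1" for \<phi>
  proof -
    have "bounded_linear \<phi>" using \<phi> cdual_UNIV_bounded_linear by (auto simp: cball_on_def)
    then have "(\<lambda>n. cmod (\<Phi> \<phi> - \<phi> (Y n))) \<longlonglongrightarrow> cmod (\<Phi> \<phi> - \<phi> y)"
      by (intro tendsto_norm tendsto_diff tendsto_const bounded_linear.tendsto[OF _ y])
    then have "cmod (\<Phi> \<phi> - \<phi> y) \<le> 0"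
      by (rule LIMSEQ_le[OF _ LIMSEQ_inverse_real_of_nat]) (use Y[OF \<phi>] in blast)
    then show ?thesis by simp
  qed
  then show ?thesis by blast
qed

lemma representable_functional:
  fixes \<Phi> :: "('f::complex_banach \<Rightarrow> complex) \<Rightarrow> complex"
  assumes hom: "\<And>a \<phi>. \<phi> \<in> cdual UNIV norm \<Longrightarrow> \<Phi> (a *\<^sub>C \<phi>) = a * \<Phi> \<phi>"
    and approx: "\<And>e. 0 < e \<Longrightarrow> \<exists>y. \<forall>\<phi>\<in>dual_ball 1. cmod (\<Phi> \<phi> - \<phi> y) \<le> e"
  obtains y where "\<And>\<phi>. \<phi> \<in> cdual UNIV norm \<Longrightarrow> \<Phi> \<phi> = \<phi> y"
proof -
  obtain y where y: "\<And>\<phi>. \<phi> \<in> dual_ball 1 \<Longrightarrow> \<Phi> \<phi> = \<phi> y"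
    using representable_if_approximable[OF approx] by blast
  have "\<Phi> \<phi> = \<phi> y" if \<phi>: "\<phi> \<in> cdual UNIV norm" for \<phi>
  proof -
    obtain t where t: "0 < t" "\<phi> \<in> dual_ball t" by (rule cdual_in_dual_ball[OF \<phi>])
    have "complex_of_real (1 / t) *\<^sub>C \<phi> \<in> dual_ball 1"
      using dual_ball_scaleC[of t \<phi> "complex_of_real (1 / t)"] t by (simp add: norm_divide)
    then have "complex_of_real (1 / t) * \<Phi> \<phi> = (complex_of_real (1 / t) *\<^sub>C \<phi>) y"
      using y hom[OF \<phi>] by metis
    then have "complex_of_real (1 / t) * \<Phi> \<phi> = complex_of_real (1 / t) * \<phi> y"
      by (simp only: scaleC_fun_def scaleC_complex_def)
    then show ?thesis using t(1) by simp
  qed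
  then show ?thesis by (rule that)
qed

text \<open>
The algebraic fact that a functional vanishing on the common kernel of finitely many functionals is a
combination of them, for evaluations at points: the combination is evaluation at the combined point.
\<close>

lemma evaluation_if_vanishes_on_annihilator:
  fixes L :: "('f::real_normed_vector \<Rightarrow>\<^sub>L real) \<Rightarrow> real"
  assumes "finite k" "linear L" "\<And>g. (\<forall>y\<in>k. blinfun_apply g y = 0) \<Longrightarrow> L g = 0"
  shows "\<exists>y. \<forall>g. L g = blinfun_apply g y"
  using assms
proof (induction k arbitrary: L rule: finite_induct)
  case empty
  then show ?case by (intro exI[of _ 0]) (simp add: blinfun.zero_right)
next
  case (insert a k)
  show ?case
  proof (cases "\<exists>g0 :: 'f \<Rightarrow>\<^sub>L real. (\<forall>y\<in>k. blinfun_apply g0 y = 0) \<and> blinfun_apply g0 a \<noteq> 0")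
    case True
    then obtain g0 :: "'f \<Rightarrow>\<^sub>L real" where g0: "\<And>y. y \<in> k \<Longrightarrow> blinfun_apply g0 y = 0" "blinfun_apply g0 a \<noteq> 0" by blast
    define c where "c = L g0 / g0 a"
    define L' where "L' = (\<lambda>g. L g - c * blinfun_apply g a)"
    have "linear L'"
      by (rule linearI)
        (simp_all add: L'_def linear_add[OF insert.prems(1)] linear_scale[OF insert.prems(1)]
          blinfun.add_left blinfun.scaleR_left algebra_simps)
    moreover have "L' g = 0" if g: "\<forall>y\<in>k. blinfun_apply g y = 0" for g
    proof -
      have "\<forall>y\<in>insert a k. blinfun_apply (g - (g a / g0 a) *\<^sub>R g0) y = 0"
        using g g0 by (auto simp: blinfun.diff_left blinfun.scaleR_left)
      then have "L (g - (g a / g0 a) *\<^sub>R g0) = 0" by (rule insert.prems(2))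
      then show ?thesis
        by (simp add: L'_def c_def linear_diff[OF insert.prems(1)] linear_scale[OF insert.prems(1)])
    qed
    ultimately obtain y where "\<And>g. L' g = blinfun_apply g y" using insert.IH by blast
    then have "L g = blinfun_apply g (y + c *\<^sub>R a)" for g
      by (simp add: L'_def blinfun.add_right blinfun.scaleR_right algebra_simps)
    then show ?thesis by blast
  next
    case False
    then show ?thesis using insert.IH[OF insert.prems(1)] insert.prems(2) by blast
  qed
qed

section \<open>Bounded holomorphic maps and the transpose\<close>

lemma Hinf_bounded: "g \<in> Hinf U \<Longrightarrow> bounded (g ` U)"
  by (simp add: Hinf_def)

lemma Hinf_has_derivative:
  assumes "g \<in> Hinf U" "x \<in> U"
  obtains D where "(g has_derivative D) (at x)" "\<And>a v. D (a *\<^sub>C v) = a *\<^sub>C D v"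
  using assms by (auto simp: Hinf_def holomorphic_map_def)

lemma norm_le_sup_norm:
  assumes "g \<in> Hinf U" "x \<in> U"
  shows "norm (g x) \<le> sup_norm U g"
  using sup_norm_le_iff[OF Hinf_bounded[OF assms(1)] sup_norm_nonneg[OF Hinf_bounded[OF assms(1)]]]
    assms(2) by blast

lemma sup_norm_le:
  assumes "g \<in> Hinf U" "0 \<le> c" "\<And>x. x \<in> U \<Longrightarrow> norm (g x) \<le> c"
  shows "sup_norm U g \<le> c"
  unfolding sup_norm_le_iff[OF Hinf_bounded[OF assms(1)] assms(2)] using assms(3) by (rule ballI)

lemma homogeneous_on_Hinf:
  "homogeneous_on (Hinf U) (sup_norm U :: ('e::complex_normed_vector \<Rightarrow> 'f::complex_normed_vector) \<Rightarrow> real)"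
  unfolding homogeneous_on_def using Hinf_scaleC sup_norm_nonneg[OF Hinf_bounded] by blast

lemma Hinf_add:
  fixes g h :: "'e::complex_normed_vector \<Rightarrow> 'f::complex_normed_vector"
  assumes "g \<in> Hinf U" "h \<in> Hinf U"
  shows "g + h \<in> Hinf U"
proof -
  have "\<exists>D. (g + h has_derivative D) (at x) \<and> (\<forall>a v. D (a *\<^sub>C v) = a *\<^sub>C D v)" if x: "x \<in> U" for x
  proof -
    obtain D where D: "(g has_derivative D) (at x)" "\<And>a v. D (a *\<^sub>C v) = a *\<^sub>C D v"
      using Hinf_has_derivative[OF assms(1) x] by blast
    obtain D' where D': "(h has_derivative D') (at x)" "\<And>a v. D' (a *\<^sub>C v) = a *\<^sub>C D' v"
      using Hinf_has_derivative[OF assms(2) x] by blast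
    show ?thesis
      using has_derivative_add[OF D(1) D'(1)] D(2) D'(2)
      by (intro exI[of _ "\<lambda>v. D v + D' v"]) (simp add: plus_fun_def scaleC_add_right)
  qed
  moreover have "bounded ((g + h) ` U)"
    using bounded_plus_comp[OF Hinf_bounded[OF assms(1)] Hinf_bounded[OF assms(2)]]
    by (simp add: plus_fun_def)
  ultimately show ?thesis
    using assms by (auto simp: Hinf_def holomorphic_map_def)
qed

lemma Hinf_diff:
  fixes g h :: "'e::complex_normed_vector \<Rightarrow> 'f::complex_normed_vector"
  assumes "g \<in> Hinf U" "h \<in> Hinf U"
  shows "g - h \<in> Hinf U"
proof -
  have "- 1 *\<^sub>C h \<in> Hinf U" using Hinf_scaleC[OF assms(2)] by blast
  from Hinf_add[OF assms(1) this] show ?thesis by simp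
qed

lemma transpose_in_Hinf:
  fixes f :: "'e::complex_normed_vector \<Rightarrow> 'f::complex_normed_vector"
  assumes f: "f \<in> Hinf U" and \<phi>: "\<phi> \<in> cdual UNIV norm"
  shows "transpose_map f \<phi> \<in> Hinf U"
proof -
  note bl = cdual_UNIV_bounded_linear[OF \<phi>]
  have sc: "\<And>a y. \<phi> (a *\<^sub>C y) = a * \<phi> y" using \<phi> by (simp add: cdual_UNIV_iff)
  have "\<exists>D. (\<phi> \<circ> f has_derivative D) (at x) \<and> (\<forall>a v. D (a *\<^sub>C v) = a *\<^sub>C D v)" if x: "x \<in> U" for x
  proof -
    obtain D where D: "(f has_derivative D) (at x)" "\<And>a v. D (a *\<^sub>C v) = a *\<^sub>C D v"
      using Hinf_has_derivative[OF f x] by blast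
    show ?thesis
      using bounded_linear.has_derivative[OF bl D(1)] D(2) sc
      by (intro exI[of _ "\<lambda>v. \<phi> (D v)"]) (simp add: o_def scaleC_complex_def)
  qed
  moreover have "bounded ((\<phi> \<circ> f) ` U)"
    using bounded_linear_image[OF Hinf_bounded[OF f] bl] by (simp add: image_comp)
  moreover have "(\<phi> \<circ> f) x = 0" if "x \<notin> U" for x
    using that f linear_0[OF bounded_linear.linear[OF bl]] by (simp add: Hinf_def)
  ultimately show ?thesis
    by (auto simp: transpose_map_def Hinf_def holomorphic_map_def)
qed

lemma sup_norm_transpose_le:
  fixes f :: "'e::complex_normed_vector \<Rightarrow> 'f::complex_normed_vector"
  assumes f: "f \<in> Hinf U" and t: "0 \<le> t" and \<phi>: "\<phi> \<in> dual_ball t"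
  shows "sup_norm U (transpose_map f \<phi>) \<le> t * sup_norm U f"
proof (rule sup_norm_le)
  show "transpose_map f \<phi> \<in> Hinf U"
    using transpose_in_Hinf[OF f] \<phi> by (simp add: cball_on_def)
  show "0 \<le> t * sup_norm U f"
    using t sup_norm_nonneg[OF Hinf_bounded[OF f]] by simp
  fix x assume x: "x \<in> U"
  have "cmod (\<phi> (f x)) \<le> t * norm (f x)" using \<phi> t by (simp add: dual_ball_iff)
  also have "\<dots> \<le> t * sup_norm U f"
    by (rule mult_left_mono[OF norm_le_sup_norm[OF f x] t])
  finally show "cmod (transpose_map f \<phi> x) \<le> t * sup_norm U f" by (simp add: transpose_map_def)
qed

lemma transpose_map_linear:
  shows transpose_map_add: "transpose_map f (\<phi> + \<psi>) = transpose_map f \<phi> + transpose_map f \<psi>"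
    and transpose_map_diff: "transpose_map f (\<phi> - \<psi>) = transpose_map f \<phi> - transpose_map f \<psi>"
    and transpose_map_scaleC: "transpose_map f (a *\<^sub>C \<phi>) = a *\<^sub>C transpose_map f \<phi>"
  by (simp_all add: transpose_map_def fun_eq_iff scaleC_fun_def)

lemma bounded_op_transpose_map:
  fixes f :: "'e::complex_normed_vector \<Rightarrow> 'f::complex_normed_vector"
  assumes f: "f \<in> Hinf U"
  shows "bounded_op (cdual UNIV norm) (cdual_norm UNIV norm) (Hinf U) (sup_norm U) (transpose_map f)"
proof -
  have "sup_norm U (transpose_map f \<phi>) \<le> sup_norm U f * cdual_norm UNIV norm \<phi>"
    if "\<phi> \<in> cdual UNIV norm" for \<phi>
    using sup_norm_transpose_le[OF f cdual_norm_nonneg[OF homogeneous_on_norm that]] that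
    by (simp add: cball_on_def mult.commute)
  then show ?thesis
    using transpose_in_Hinf[OF f]
    by (auto simp: bounded_op_def transpose_map_linear)
qed

lemma Hinf_dualD:
  assumes "u \<in> Hinf_dual U"
  shows Hinf_dual_add: "\<And>g h. \<lbrakk>g \<in> Hinf U; h \<in> Hinf U\<rbrakk> \<Longrightarrow> u (g + h) = u g + u h"
    and Hinf_dual_scaleC: "\<And>a g. g \<in> Hinf U \<Longrightarrow> u (a *\<^sub>C g) = a * u g"
    and Hinf_dual_bound: "\<And>g. g \<in> Hinf U \<Longrightarrow> cmod (u g) \<le> Hinf_dual_norm U u * sup_norm U g"
  using assms cdual_bound[OF homogeneous_on_Hinf assms]
  by (auto simp: cdual_def bounded_op_def scaleC_complex_def)

text \<open>
Elements of the dual are additive only on the carrier, so the difference is split inside the range of the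
transpose.
\<close>

lemma Hinf_dual_transpose_diff:
  fixes f :: "'e::complex_normed_vector \<Rightarrow> 'f::complex_normed_vector"
  assumes u: "u \<in> Hinf_dual U" and f: "f \<in> Hinf U"
    and \<phi>: "\<phi> \<in> cdual UNIV norm" and \<psi>: "\<psi> \<in> cdual UNIV norm"
  shows "u (transpose_map f \<phi>) - u (transpose_map f \<psi>) = u (transpose_map f \<phi> - transpose_map f \<psi>)"
proof -
  have "u (transpose_map f (\<phi> - \<psi>) + transpose_map f \<psi>) =
      u (transpose_map f (\<phi> - \<psi>)) + u (transpose_map f \<psi>)"
    by (intro Hinf_dual_add[OF u] transpose_in_Hinf[OF f] cdual_diff \<phi> \<psi>)
  then show ?thesis by (simp add: transpose_map_diff)
qed

section \<open>The predual and the linearization\<close>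

lemma evaluation_transpose:
  fixes f :: "'e::complex_normed_vector \<Rightarrow> 'f::complex_normed_vector"
  assumes "f \<in> Hinf U" "\<phi> \<in> cdual UNIV norm"
  shows "evaluation U x (transpose_map f \<phi>) = \<phi> (f x)"
  using transpose_in_Hinf[OF assms] by (simp add: evaluation_def) (simp add: transpose_map_def)

lemma evaluation_in_unit_ball:
  assumes "x \<in> U"
  shows "evaluation U x \<in> cball_on (Hinf_dual U) (Hinf_dual_norm U) 1"
proof -
  have bd: "cmod (evaluation U x g) \<le> 1 * sup_norm U g" if "g \<in> Hinf U" for g
    using norm_le_sup_norm[OF that assms] that by (simp add: evaluation_def)
  then have "\<exists>K. \<forall>g\<in>Hinf U. cmod (evaluation U x g) \<le> K * sup_norm U g" by blast
  then have "evaluation U x \<in> Hinf_dual U"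
    by (simp add: cdual_def bounded_op_def evaluation_def Hinf_add Hinf_scaleC)
      (simp add: scaleC_fun_def)
  then show ?thesis
    using bd cball_cdual_iff[OF homogeneous_on_Hinf zero_le_one, of "evaluation U x" U] by blast
qed

abbreviation evaluation_span :: "'e::complex_normed_vector set \<Rightarrow> (('e \<Rightarrow> complex) \<Rightarrow> complex) set"
  where "evaluation_span U \<equiv> module.span scaleC (evaluation U ` U)"

lemma evaluation_span_subset_dual: "evaluation_span U \<subseteq> Hinf_dual U"
  using evaluation_in_unit_ball
  by (intro complex_space.span_minimal subspace_cdual) (auto simp: cball_on_def)

lemma Ginf_iff:
  "u \<in> Ginf U \<longleftrightarrow>
    u \<in> Hinf_dual U \<and> (\<forall>e>0. \<exists>v\<in>evaluation_span U. Hinf_dual_norm U (u - v) < e)"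
proof -
  interpret Metric_space "Hinf_dual U" "norm_dist (Hinf_dual U) (Hinf_dual_norm U)"
    by (rule Metric_space_Hinf_dual)
  show ?thesis
    using evaluation_span_subset_dual[of U]
    by (auto simp: Ginf_def norm_topology_def metric_closure_of norm_dist_def in_mball; blast)
qed

lemma Ginf_subset_dual: "Ginf U \<subseteq> Hinf_dual U"
  by (auto simp: Ginf_iff)

lemma evaluation_span_subset_Ginf: "evaluation_span U \<subseteq> Ginf U"
proof
  fix u assume u: "u \<in> evaluation_span U"
  then have "u \<in> Hinf_dual U" using evaluation_span_subset_dual by blast
  from cdual_norm_scaleC_le[OF homogeneous_on_Hinf this, of 0]
  have "Hinf_dual_norm U (u - u) \<le> 0" by simp
  then have "\<exists>v\<in>evaluation_span U. Hinf_dual_norm U (u - v) < e" if "0 < e" for e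
    using u that by (intro bexI[of _ u]) auto
  then show "u \<in> Ginf U"
    using \<open>u \<in> Hinf_dual U\<close> by (simp add: Ginf_iff)
qed

lemma evaluation_in_Ginf: "x \<in> U \<Longrightarrow> evaluation U x \<in> Ginf U"
  using evaluation_span_subset_Ginf complex_space.span_base by blast

lemma subspace_Ginf: "complex_space.subspace (Ginf U)"
proof (rule complex_space.subspaceI)
  show "0 \<in> Ginf U"
    using evaluation_span_subset_Ginf complex_space.span_zero by blast
next
  fix u u' assume u: "u \<in> Ginf U" and u': "u' \<in> Ginf U"
  then have dual: "u \<in> Hinf_dual U" "u' \<in> Hinf_dual U" using Ginf_subset_dual by blast+
  have "\<exists>w\<in>evaluation_span U. Hinf_dual_norm U (u + u' - w) < e" if e: "0 < e" for e
  proof -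
    obtain v where v: "v \<in> evaluation_span U" "Hinf_dual_norm U (u - v) < e / 2"
      using u e unfolding Ginf_iff by (meson half_gt_zero)
    obtain v' where v': "v' \<in> evaluation_span U" "Hinf_dual_norm U (u' - v') < e / 2"
      using u' e unfolding Ginf_iff by (meson half_gt_zero)
    have "u - v \<in> Hinf_dual U" "u' - v' \<in> Hinf_dual U"
      using dual v(1) v'(1) evaluation_span_subset_dual by (blast intro: cdual_diff)+
    from cdual_norm_add[OF homogeneous_on_Hinf this]
    have "Hinf_dual_norm U (u + u' - (v + v')) < e"
      using v(2) v'(2) by (simp add: add_diff_add)
    then show ?thesis using complex_space.span_add[OF v(1) v'(1)] by blast
  qed
  then show "u + u' \<in> Ginf U"
    using cdual_add[OF dual] by (simp add: Ginf_iff)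
next
  fix a u assume u: "u \<in> Ginf U"
  then have dual: "u \<in> Hinf_dual U" using Ginf_subset_dual by blast
  have "\<exists>w\<in>evaluation_span U. Hinf_dual_norm U (a *\<^sub>C u - w) < e" if e: "0 < e" for e
  proof -
    have "0 < e / (cmod a + 1)" using e by (simp add: add_nonneg_pos)
    then obtain v where v: "v \<in> evaluation_span U" "Hinf_dual_norm U (u - v) < e / (cmod a + 1)"
      using u unfolding Ginf_iff by blast
    have uv: "u - v \<in> Hinf_dual U"
      using dual v(1) evaluation_span_subset_dual by (blast intro: cdual_diff)
    have "Hinf_dual_norm U (a *\<^sub>C u - a *\<^sub>C v) \<le> cmod a * Hinf_dual_norm U (u - v)"
      using cdual_norm_scaleC_le[OF homogeneous_on_Hinf uv, of a]
      by (simp add: complex_space.scale_right_diff_distrib)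
    also have "\<dots> \<le> (cmod a + 1) * Hinf_dual_norm U (u - v)"
      using cdual_norm_nonneg[OF homogeneous_on_Hinf uv] by (simp add: algebra_simps)
    also have "\<dots> < e"
      using v(2) by (simp add: pos_less_divide_eq add_nonneg_pos mult.commute)
    finally show ?thesis using complex_space.span_scale[OF v(1)] by blast
  qed
  then show "a *\<^sub>C u \<in> Ginf U"
    using cdual_scaleC[OF dual] by (simp add: Ginf_iff)
qed

text \<open>
Elements of the span of the evaluations are represented by the corresponding combinations of values of f,
and the representation survives norm limits because F is complete. The vector y is the value of
the linearization at u.
\<close>

lemma Ginf_represented:
  fixes f :: "'e::complex_normed_vector \<Rightarrow> 'f::complex_banach"
  assumes f: "f \<in> Hinf U" and u: "u \<in> Ginf U"
  obtains y where "\<And>\<phi>. \<phi> \<in> cdual UNIV norm \<Longrightarrow> u (transpose_map f \<phi>) = \<phi> y"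
proof -
  let ?R = "{v. \<exists>y. \<forall>\<phi>\<in>cdual UNIV norm. v (transpose_map f \<phi>) = \<phi> y}"
  have "complex_space.subspace ?R"
  proof (rule complex_space.subspaceI)
    show "0 \<in> ?R"
      by (auto simp: cdual_UNIV_bounded_linear bounded_linear.linear linear_0 intro!: exI[of _ 0])
  next
    fix v w assume "v \<in> ?R" "w \<in> ?R"
    then obtain y z where "\<And>\<phi>. \<phi> \<in> cdual UNIV norm \<Longrightarrow> v (transpose_map f \<phi>) = \<phi> y"
      "\<And>\<phi>. \<phi> \<in> cdual UNIV norm \<Longrightarrow> w (transpose_map f \<phi>) = \<phi> z" by blast
    then have "(v + w) (transpose_map f \<phi>) = \<phi> (y + z)" if "\<phi> \<in> cdual UNIV norm" for \<phi>
      using that by (simp add: cdual_UNIV_iff)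
    then show "v + w \<in> ?R" by blast
  next
    fix a v assume "v \<in> ?R"
    then obtain y where "\<And>\<phi>. \<phi> \<in> cdual UNIV norm \<Longrightarrow> v (transpose_map f \<phi>) = \<phi> y" by blast
    then have "(a *\<^sub>C v) (transpose_map f \<phi>) = \<phi> (a *\<^sub>C y)" if "\<phi> \<in> cdual UNIV norm" for \<phi>
      using that by (simp add: cdual_UNIV_iff scaleC_fun_def scaleC_complex_def)
    then show "a *\<^sub>C v \<in> ?R" by blast
  qed
  moreover have "evaluation U ` U \<subseteq> ?R"
    using evaluation_transpose[OF f] by blast
  ultimately have span: "evaluation_span U \<subseteq> ?R" by (intro complex_space.span_minimal)
  have dual: "u \<in> Hinf_dual U" using u Ginf_subset_dual by blast
  have "\<exists>y. \<forall>\<phi>\<in>dual_ball 1. cmod (u (transpose_map f \<phi>) - \<phi> y) \<le> e" if e: "0 < e" for e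
  proof -
    have M: "0 \<le> sup_norm U f" by (rule sup_norm_nonneg[OF Hinf_bounded[OF f]])
    then have "0 < e / (sup_norm U f + 1)" using e by simp
    then obtain v where v: "v \<in> evaluation_span U" "Hinf_dual_norm U (u - v) < e / (sup_norm U f + 1)"
      using u unfolding Ginf_iff by blast
    then obtain y where y: "\<And>\<phi>. \<phi> \<in> cdual UNIV norm \<Longrightarrow> v (transpose_map f \<phi>) = \<phi> y"
      using span by blast
    have uv: "u - v \<in> Hinf_dual U"
      using dual v(1) evaluation_span_subset_dual by (blast intro: cdual_diff)
    have "cmod (u (transpose_map f \<phi>) - \<phi> y) \<le> e" if \<phi>: "\<phi> \<in> dual_ball 1" for \<phi>
    proof -
      have \<phi>D: "\<phi> \<in> cdual UNIV norm" using \<phi> by (simp add: cball_on_def)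
      have "cmod ((u - v) (transpose_map f \<phi>)) \<le>
          Hinf_dual_norm U (u - v) * sup_norm U (transpose_map f \<phi>)"
        by (rule Hinf_dual_bound[OF uv transpose_in_Hinf[OF f \<phi>D]])
      also have "\<dots> \<le> e / (sup_norm U f + 1) * (sup_norm U f + 1)"
        using v(2) sup_norm_transpose_le[OF f zero_le_one \<phi>] M e
          sup_norm_nonneg[OF Hinf_bounded[OF transpose_in_Hinf[OF f \<phi>D]]]
        by (intro mult_mono) auto
      finally show ?thesis using M y[OF \<phi>D] by simp
    qed
    then show ?thesis by blast
  qed
  moreover have "u (transpose_map f (a *\<^sub>C \<phi>)) = a * u (transpose_map f \<phi>)"
    if "\<phi> \<in> cdual UNIV norm" for a \<phi>
    by (simp add: transpose_map_scaleC Hinf_dual_scaleC[OF dual transpose_in_Hinf[OF f that]])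
  ultimately show ?thesis
    using representable_functional[of "\<lambda>\<phi>. u (transpose_map f \<phi>)"] that by blast
qed

lemma bounded_op_Ginf_eqI:
  fixes T T' :: "(('e::complex_normed_vector \<Rightarrow> complex) \<Rightarrow> complex) \<Rightarrow> 'f::complex_normed_vector"
  assumes T: "bounded_op (Ginf U) (Hinf_dual_norm U) UNIV norm T"
    and T': "bounded_op (Ginf U) (Hinf_dual_norm U) UNIV norm T'"
    and eq: "\<And>x. x \<in> U \<Longrightarrow> T (evaluation U x) = T' (evaluation U x)"
    and u: "u \<in> Ginf U"
  shows "T u = T' u"
proof -
  have add: "T (v + w) = T v + T w" "T' (v + w) = T' v + T' w" if "v \<in> Ginf U" "w \<in> Ginf U" for v w
    using T T' that by (auto simp: bounded_op_def)
  have sc: "T (a *\<^sub>C v) = a *\<^sub>C T v" "T' (a *\<^sub>C v) = a *\<^sub>C T' v" if "v \<in> Ginf U" for a v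
    using T T' that by (auto simp: bounded_op_def)
  obtain K where K: "\<And>v. v \<in> Ginf U \<Longrightarrow> norm (T v) \<le> K * Hinf_dual_norm U v"
    using bounded_op_bound[OF T] by metis
  obtain K' where K': "\<And>v. v \<in> Ginf U \<Longrightarrow> norm (T' v) \<le> K' * Hinf_dual_norm U v"
    using bounded_op_bound[OF T'] by metis
  have "complex_space.subspace {v \<in> Ginf U. T v = T' v}"
  proof (rule complex_space.subspaceI)
    have zero: "0 \<in> Ginf U" by (rule complex_space.subspace_0[OF subspace_Ginf])
    show "0 \<in> {v \<in> Ginf U. T v = T' v}"
      using sc[OF zero, of 0] zero by simp
  qed (auto simp: add sc complex_space.subspace_add[OF subspace_Ginf]
      complex_space.subspace_scale[OF subspace_Ginf])
  then have span: "evaluation_span U \<subseteq> {v \<in> Ginf U. T v = T' v}"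
    by (rule complex_space.span_minimal[rotated]) (use eq evaluation_in_Ginf in blast)
  have "norm (T u - T' u) \<le> 0 + e" if e: "0 < e" for e
  proof -
    define C where "C = \<bar>K\<bar> + \<bar>K'\<bar> + 1"
    have C: "0 < C" by (simp add: C_def)
    then obtain v where v: "v \<in> evaluation_span U" "Hinf_dual_norm U (u - v) < e / C"
      using u e unfolding Ginf_iff by (meson divide_pos_pos)
    have v': "v \<in> Ginf U" "T v = T' v" using v(1) span by blast+
    have uv: "u - v \<in> Ginf U" by (rule complex_space.subspace_diff[OF subspace_Ginf u v'(1)])
    have "T u - T' u = T (u - v) - T' (u - v)"
      using add[OF uv v'(1)] v'(2) by simp
    then have "norm (T u - T' u) \<le> norm (T (u - v)) + norm (T' (u - v))"
      by (simp add: norm_triangle_ineq4)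
    also have "\<dots> \<le> K * Hinf_dual_norm U (u - v) + K' * Hinf_dual_norm U (u - v)"
      by (rule add_mono[OF K[OF uv] K'[OF uv]])
    also have "\<dots> = (K + K') * Hinf_dual_norm U (u - v)"
      by (simp add: distrib_right)
    also have "\<dots> \<le> C * Hinf_dual_norm U (u - v)"
      using cdual_norm_nonneg[OF homogeneous_on_Hinf] uv Ginf_subset_dual
      by (intro mult_right_mono) (auto simp: C_def)
    also have "\<dots> \<le> e"
      using v(2) C by (simp add: pos_less_divide_eq mult.commute)
    finally show ?thesis by simp
  qed
  then have "norm (T u - T' u) \<le> 0" by (rule field_le_epsilon)
  then show ?thesis by simp
qed

text \<open>
Existence and uniqueness in Mujica's theorem. The defining property of T u is that \<phi> (T u) = u (\<phi> \<circ> f) for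
all \<phi>; since functionals separate points, linearity is read off from this identity, and the bound comes
from norming functionals.
\<close>

lemma
  fixes f :: "'e::complex_normed_vector \<Rightarrow> 'f::complex_banach"
  assumes f: "f \<in> Hinf U"
  shows bounded_op_linearization:
      "bounded_op (Ginf U) (Hinf_dual_norm U) UNIV norm (linearization U f)"
    and linearization_evaluation: "x \<in> U \<Longrightarrow> linearization U f (evaluation U x) = f x"
    and linearization_transpose: "\<lbrakk>u \<in> Ginf U; \<phi> \<in> cdual UNIV norm\<rbrakk> \<Longrightarrow>
      \<phi> (linearization U f u) = u (transpose_map f \<phi>)"
proof -
  have "\<exists>y. \<forall>\<phi>\<in>cdual UNIV norm. u (transpose_map f \<phi>) = \<phi> y" if "u \<in> Ginf U" for u
    using Ginf_represented[OF f that] by metis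
  then obtain Y where Y: "\<And>u \<phi>. \<lbrakk>u \<in> Ginf U; \<phi> \<in> cdual UNIV norm\<rbrakk> \<Longrightarrow> \<phi> (Y u) = u (transpose_map f \<phi>)"
    by metis
  define T where "T = (\<lambda>u. if u \<in> Ginf U then Y u else 0)"
  have T: "\<phi> (T u) = u (transpose_map f \<phi>)" if "u \<in> Ginf U" "\<phi> \<in> cdual UNIV norm" for u \<phi>
    using Y that by (simp add: T_def)
  have ball: "\<phi> \<in> cdual UNIV norm" if "\<phi> \<in> dual_ball 1" for \<phi> :: "'f \<Rightarrow> complex"
    using that by (simp add: cball_on_def)
  have bounded: "norm (T u) \<le> sup_norm U f * Hinf_dual_norm U u" if u: "u \<in> Ginf U" for u
  proof (rule norm_le_dual_ball)
    fix \<phi> :: "'f \<Rightarrow> complex" assume \<phi>: "\<phi> \<in> dual_ball 1"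
    have dual: "u \<in> Hinf_dual U" using u Ginf_subset_dual by blast
    have "cmod (\<phi> (T u)) \<le> Hinf_dual_norm U u * sup_norm U (transpose_map f \<phi>)"
      using Hinf_dual_bound[OF dual transpose_in_Hinf[OF f ball[OF \<phi>]]] T[OF u ball[OF \<phi>]] by simp
    also have "\<dots> \<le> Hinf_dual_norm U u * sup_norm U f"
      using sup_norm_transpose_le[OF f zero_le_one \<phi>] cdual_norm_nonneg[OF homogeneous_on_Hinf dual]
      by (simp add: mult_left_mono)
    finally show "cmod (\<phi> (T u)) \<le> sup_norm U f * Hinf_dual_norm U u"
      by (simp add: mult.commute)
  qed
  have op: "bounded_op (Ginf U) (Hinf_dual_norm U) UNIV norm T"
    unfolding bounded_op_def
  proof (intro conjI ballI allI)
    fix u v assume uv: "u \<in> Ginf U" "v \<in> Ginf U"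
    show "T (u + v) = T u + T v"
    proof (rule dual_ball_separates)
      fix \<phi> :: "'f \<Rightarrow> complex" assume \<phi>: "\<phi> \<in> dual_ball 1"
      have "\<phi> (T u + T v) = \<phi> (T u) + \<phi> (T v)" using ball[OF \<phi>] by (simp add: cdual_UNIV_iff)
      then show "\<phi> (T (u + v)) = \<phi> (T u + T v)"
        using uv ball[OF \<phi>] by (simp add: T complex_space.subspace_add[OF subspace_Ginf])
    qed
  next
    fix a u assume u: "u \<in> Ginf U"
    show "T (a *\<^sub>C u) = a *\<^sub>C T u"
    proof (rule dual_ball_separates)
      fix \<phi> :: "'f \<Rightarrow> complex" assume \<phi>: "\<phi> \<in> dual_ball 1"
      have "\<phi> (a *\<^sub>C T u) = a * \<phi> (T u)" using ball[OF \<phi>] by (simp add: cdual_UNIV_iff)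
      moreover have "\<phi> (T (a *\<^sub>C u)) = (a *\<^sub>C u) (transpose_map f \<phi>)"
        by (rule T[OF complex_space.subspace_scale[OF subspace_Ginf u] ball[OF \<phi>]])
      ultimately show "\<phi> (T (a *\<^sub>C u)) = \<phi> (a *\<^sub>C T u)"
        using T[OF u ball[OF \<phi>]] by (simp add: scaleC_fun_def scaleC_complex_def)
    qed
  qed (use bounded in blast)+
  have eval: "T (evaluation U x) = f x" if "x \<in> U" for x
  proof (rule dual_ball_separates)
    fix \<phi> :: "'f \<Rightarrow> complex" assume "\<phi> \<in> dual_ball 1"
    then show "\<phi> (T (evaluation U x)) = \<phi> (f x)"
      using T[OF evaluation_in_Ginf[OF that] ball] evaluation_transpose[OF f ball] by simp
  qed
  have "linearization U f = T"
    unfolding linearization_def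
  proof (rule the_equality)
    fix T' assume *: "bounded_op (Ginf U) (Hinf_dual_norm U) UNIV norm T' \<and>
      (\<forall>u. u \<notin> Ginf U \<longrightarrow> T' u = 0) \<and> (\<forall>x\<in>U. T' (evaluation U x) = f x)"
    show "T' = T"
    proof
      fix u show "T' u = T u"
      proof (cases "u \<in> Ginf U")
        case True
        show ?thesis
          by (rule bounded_op_Ginf_eqI[OF conjunct1[OF *] op _ True]) (use * eval in simp)
      next
        case False
        with * show ?thesis by (simp add: T_def)
      qed
    qed
  next
    have "\<forall>u. u \<notin> Ginf U \<longrightarrow> T u = 0" by (simp add: T_def)
    with op eval show "bounded_op (Ginf U) (Hinf_dual_norm U) UNIV norm T \<and>
      (\<forall>u. u \<notin> Ginf U \<longrightarrow> T u = 0) \<and> (\<forall>x\<in>U. T (evaluation U x) = f x)" by blast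
  qed
  note eq = this
  show "bounded_op (Ginf U) (Hinf_dual_norm U) UNIV norm (linearization U f)"
    unfolding eq by (rule op)
  show "linearization U f (evaluation U x) = f x" if "x \<in> U"
    unfolding eq by (rule eval[OF that])
  show "\<phi> (linearization U f u) = u (transpose_map f \<phi>)" if "u \<in> Ginf U" "\<phi> \<in> cdual UNIV norm"
    unfolding eq by (rule T[OF that])
qed

section \<open>Finite nets\<close>

text \<open>
A finite net k for the first variable reduces the comparison of y and y' to the finitely many numbers
b x0 y with x0 in k. These lie in a disc, so rounding them to a finite set of centres sorts
B into finitely many classes; one representative of each class gives the net.
\<close>

lemma finite_net_transpose:
  fixes b :: "'a \<Rightarrow> 'b \<Rightarrow> complex"
  assumes bd: "\<And>x y. \<lbrakk>x \<in> A; y \<in> B\<rbrakk> \<Longrightarrow> cmod (b x y) \<le> M"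
    and net: "\<And>e. 0 < e \<Longrightarrow> \<exists>k\<subseteq>A. finite k \<and> (\<forall>x\<in>A. \<exists>x0\<in>k. \<forall>y\<in>B. cmod (b x y - b x0 y) \<le> e)"
    and e: "0 < e"
  obtains l where "l \<subseteq> B" "finite l" "\<And>y. y \<in> B \<Longrightarrow> \<exists>y0\<in>l. \<forall>x\<in>A. cmod (b x y - b x y0) \<le> e"
proof -
  obtain k where k: "k \<subseteq> A" "finite k" "\<And>x. x \<in> A \<Longrightarrow> \<exists>x0\<in>k. \<forall>y\<in>B. cmod (b x y - b x0 y) \<le> e / 4"
    using net[of "e / 4"] e by (auto; blast)
  \<comment> \<open>Each of two rounded values loses e / 8, and each of two passages to the net loses e / 4.\<close>
  have "compact (cball (0::complex) M)" by simp
  then obtain c where c: "finite c" "cball (0::complex) M \<subseteq> (\<Union>z\<in>c. ball z (e / 8))"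
    using e unfolding compact_eq_totally_bounded by (meson divide_pos_pos zero_less_numeral)
  have "\<exists>w\<in>c. cmod (z - w) \<le> e / 8" if "cmod z \<le> M" for z
  proof -
    have "z \<in> cball 0 M" using that by simp
    then obtain w where "w \<in> c" "dist w z < e / 8" using c(2) by auto
    then show ?thesis by (intro bexI[of _ w]) (auto simp: dist_norm norm_minus_commute)
  qed
  then obtain r where r: "\<And>z. cmod z \<le> M \<Longrightarrow> r z \<in> c \<and> cmod (z - r z) \<le> e / 8" by metis
  \<comment> \<open>The class of y: its rounded values at the net.\<close>
  define q where "q = (\<lambda>y. restrict (\<lambda>x. r (b x y)) k)"
  have "q ` B \<subseteq> k \<rightarrow>\<^sub>E c"
    using r bd k(1) by (auto simp: q_def)
  then have fin: "finite (q ` B)"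
    using finite_subset finite_PiE k(2) c(1) by metis
  define l where "l = inv_into B q ` q ` B"
  show ?thesis
  proof
    show "l \<subseteq> B" by (auto simp: l_def inv_into_into)
    show "finite l" using fin by (simp add: l_def)
    fix y assume y: "y \<in> B"
    define y0 where "y0 = inv_into B q (q y)"
    have y0: "y0 \<in> B" "y0 \<in> l" "q y0 = q y"
      using y by (auto simp: y0_def l_def inv_into_into f_inv_into_f)
    have "cmod (b x y - b x y0) \<le> e" if x: "x \<in> A" for x
    proof -
      obtain x0 where x0: "x0 \<in> k" "\<And>y. y \<in> B \<Longrightarrow> cmod (b x y - b x0 y) \<le> e / 4"
        using k(3)[OF x] by blast
      have "r (b x0 y) = r (b x0 y0)"
        using fun_cong[OF y0(3), of x0] x0(1) by (simp add: q_def)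
      moreover have "cmod (b x0 y - r (b x0 y)) \<le> e / 8" "cmod (b x0 y0 - r (b x0 y0)) \<le> e / 8"
        using r bd x0(1) k(1) y y0(1) by blast+
      ultimately have "cmod (b x0 y - b x0 y0) \<le> e / 8 + e / 8"
        using norm_triangle_ineq4[of "b x0 y - r (b x0 y)" "b x0 y0 - r (b x0 y0)"] by simp
      moreover have "b x y - b x y0 = (b x y - b x0 y) + (b x0 y - b x0 y0) - (b x y0 - b x0 y0)"
        by simp
      then have "cmod (b x y - b x y0) \<le>
          cmod (b x y - b x0 y) + cmod (b x0 y - b x0 y0) + cmod (b x y0 - b x0 y0)"
        by (smt (verit) norm_triangle_ineq norm_triangle_ineq4)
      ultimately show ?thesis
        using x0(2)[OF y] x0(2)[OF y0(1)] e by linarith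
    qed
    then show "\<exists>y0\<in>l. \<forall>x\<in>A. cmod (b x y - b x y0) \<le> e" using y0(2) by blast
  qed
qed

lemma compact_closure_if_finite_nets:
  fixes S :: "'f::banach set"
  assumes net: "\<And>e. 0 < e \<Longrightarrow> \<exists>k. finite k \<and> (\<forall>y\<in>S. \<exists>z\<in>k. norm (y - z) \<le> e)"
  shows "compact (closure S)"
  unfolding compact_eq_totally_bounded
proof (intro conjI allI impI)
  show "complete (closure S)" by (simp add: complete_eq_closed)
  fix e :: real assume e: "0 < e"
  then obtain k where k: "finite k" "\<And>y. y \<in> S \<Longrightarrow> \<exists>z\<in>k. norm (y - z) \<le> e / 2"
    using net[of "e / 2"] by auto
  have "S \<subseteq> (\<Union>z\<in>k. cball z (e / 2))"
    using k(2) by (force simp: dist_norm norm_minus_commute)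
  then have "closure S \<subseteq> (\<Union>z\<in>k. cball z (e / 2))"
    using k(1) by (intro closure_minimal closed_UN) auto
  also have "\<dots> \<subseteq> (\<Union>z\<in>k. ball z e)"
    using e by (intro UN_mono) auto
  finally show "\<exists>k. finite k \<and> closure S \<subseteq> (\<Union>z\<in>k. ball z e)" using k(1) by blast
qed

lemma compact_finite_net:
  fixes S :: "'f::metric_space set"
  assumes K: "compact (closure S)" and d: "0 < d"
  shows "\<exists>k. finite k \<and> (\<forall>y\<in>S. \<exists>z\<in>k. dist y z < d)"
proof -
  obtain k where k: "finite k" "closure S \<subseteq> (\<Union>z\<in>k. ball z d)"
    using K[unfolded compact_eq_totally_bounded] d by metis
  have "\<exists>z\<in>k. dist y z < d" if "y \<in> S" for y
  proof -
    have "y \<in> (\<Union>z\<in>k. ball z d)" using that closure_subset[of S] k(2) by blast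
    then show ?thesis by (auto simp: dist_commute)
  qed
  with k(1) show ?thesis by metis
qed

section \<open>The weak* and bounded weak* topologies\<close>

lemma openin_weak_star_basic:
  assumes "x \<in> V" "open S"
  shows "openin (weak_star_topology V N) {\<phi> \<in> cdual V N. \<phi> x \<in> S}"
  unfolding weak_star_topology_def
  by (rule topology_generated_by_Basis, rule CollectI,
      rule exI[of _ x], rule exI[of _ S]) (simp add: assms)

text \<open>
The ball as a closed subset of a product of discs, ready for Tychonoff's theorem.
\<close>

lemma dual_ball_eq:
  assumes "0 \<le> t"
  shows "(dual_ball t :: ('f::complex_normed_vector \<Rightarrow> complex) set) =
    Pi\<^sub>E UNIV (\<lambda>x. cball 0 (t * norm x)) \<inter>
      ((\<Inter>x. \<Inter>y. {\<phi>. \<phi> (x + y) = \<phi> x + \<phi> y}) \<inter> (\<Inter>a. \<Inter>x. {\<phi>. \<phi> (a *\<^sub>C x) = a * \<phi> x}))"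
  (is "_ = ?P \<inter> ?L")
proof (intro set_eqI)
  fix \<phi> :: "'f \<Rightarrow> complex"
  have P: "\<phi> \<in> ?P \<longleftrightarrow> (\<forall>x. cmod (\<phi> x) \<le> t * norm x)"
    by (simp add: PiE_UNIV_domain Pi_iff)
  have L: "\<phi> \<in> (\<Inter>x. \<Inter>y. {\<phi>. \<phi> (x + y) = \<phi> x + \<phi> y}) \<longleftrightarrow>
      (\<forall>x y. \<phi> (x + y) = \<phi> x + \<phi> y)"
    "\<phi> \<in> (\<Inter>a. \<Inter>x. {\<phi>. \<phi> (a *\<^sub>C x) = a * \<phi> x}) \<longleftrightarrow> (\<forall>a x. \<phi> (a *\<^sub>C x) = a * \<phi> x)"
    by simp_all
  have ex: "\<exists>K. \<forall>x. cmod (\<phi> x) \<le> K * norm x" if "\<forall>x. cmod (\<phi> x) \<le> t * norm x"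
    using that by (rule exI)
  show "\<phi> \<in> dual_ball t \<longleftrightarrow> \<phi> \<in> ?P \<inter> ?L"
    unfolding Int_iff P L dual_ball_iff[OF assms] cdual_UNIV_iff
    by (intro iffI; elim conjE; intro conjI; (assumption | rule ex)?)
qed

text \<open>
The ball is closed in a product of discs, hence compact for pointwise convergence on the space of all
functions, and that topology induces the weak* topology on it.
\<close>

theorem Banach_Alaoglu:
  assumes t: "0 \<le> t"
  shows "compactin (weak_star_topology UNIV norm) (dual_ball t :: ('f::complex_normed_vector \<Rightarrow> complex) set)"
proof -
  let ?B = "dual_ball t :: ('f \<Rightarrow> complex) set"
  have "compactin (product_topology (\<lambda>_::'f. euclidean :: complex topology) UNIV)
      (Pi\<^sub>E UNIV (\<lambda>x. cball 0 (t * norm x)))"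
    by (simp add: compactin_PiE)
  then have "compact (Pi\<^sub>E UNIV (\<lambda>x::'f. cball (0::complex) (t * norm x)))"
    by (simp add: euclidean_product_topology flip: compactin_euclidean_iff)
  moreover have "closed ((\<Inter>x. \<Inter>y. {\<phi> :: 'f \<Rightarrow> complex. \<phi> (x + y) = \<phi> x + \<phi> y}) \<inter>
      (\<Inter>a. \<Inter>x. {\<phi>. \<phi> (a *\<^sub>C x) = a * \<phi> x}))"
    by (intro closed_Int closed_INT ballI closed_Collect_eq continuous_intros
        continuous_on_product_coordinates)
  ultimately have "compact ?B"
    unfolding dual_ball_eq[OF t] by (rule compact_Int_closed)
  then have "compactin (top_of_set ?B) ?B"
    by (simp add: compactin_subtopology)
  moreover have "continuous_map (top_of_set ?B) (weak_star_topology UNIV norm) id"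
    unfolding weak_star_topology_def
  proof (rule continuous_on_generated_topo)
    fix W assume "W \<in> {{\<phi> \<in> cdual UNIV norm. \<phi> x \<in> S} | (x::'f) S. x \<in> UNIV \<and> open S}"
    then obtain x S where W: "W = {\<phi> \<in> cdual UNIV norm. \<phi> (x::'f) \<in> S}" and S: "open S" by blast
    have "open ((\<lambda>\<phi>::'f \<Rightarrow> complex. \<phi> x) -` S)"
      by (rule open_vimage[OF S continuous_on_product_coordinates])
    moreover have "id -` W \<inter> topspace (top_of_set ?B) = ?B \<inter> (\<lambda>\<phi>. \<phi> x) -` S"
      by (auto simp: W cball_on_def)
    ultimately show "openin (top_of_set ?B) (id -` W \<inter> topspace (top_of_set ?B))"
      by (simp only: openin_open_Int)
  next
    have "\<Union> {{\<phi> \<in> cdual UNIV norm. \<phi> x \<in> S} | (x::'f) S. x \<in> UNIV \<and> open S} = cdual UNIV norm"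
      using topspace_weak_star_topology[of "UNIV :: 'f set" norm]
      unfolding weak_star_topology_def topology_generated_by_topspace by simp
    then show "id ` topspace (top_of_set ?B) \<subseteq>
        \<Union> {{\<phi> \<in> cdual UNIV norm. \<phi> x \<in> S} | (x::'f) S. x \<in> UNIV \<and> open S}"
      by (auto simp: cball_on_def)
  qed
  ultimately have "compactin (weak_star_topology UNIV norm) (id ` ?B)"
    by (rule image_compactin)
  then show ?thesis by simp
qed

lemma closedin_dual_ball:
  "0 \<le> t \<Longrightarrow> closedin (weak_star_topology UNIV norm)
    (dual_ball t :: ('f::complex_normed_vector \<Rightarrow> complex) set)"
  by (rule closedin_weak_star_cball_on) auto

lemma closedin_bw_star_UNIV:
  "closedin (bw_star_topology UNIV (norm :: 'f::complex_normed_vector \<Rightarrow> real)) A \<longleftrightarrow>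
    bw_star_closed UNIV norm A"
  by (rule closedin_bw_star) auto

lemma topspace_bw_star_UNIV:
  "topspace (bw_star_topology UNIV (norm :: 'f::complex_normed_vector \<Rightarrow> real)) = cdual UNIV norm"
proof
  show "topspace (bw_star_topology UNIV norm) \<subseteq> cdual UNIV (norm :: 'f \<Rightarrow> real)"
    using closedin_bw_star_UNIV closedin_topspace unfolding bw_star_closed_def by blast
  have "cdual UNIV norm \<inter> dual_ball t = (dual_ball t :: ('f \<Rightarrow> complex) set)" for t :: real
    by (auto simp: cball_on_def)
  then have "bw_star_closed UNIV norm (cdual UNIV (norm :: 'f \<Rightarrow> real))"
    using closedin_dual_ball[where 'f = 'f] by (simp add: bw_star_closed_def)
  then show "cdual UNIV (norm :: 'f \<Rightarrow> real) \<subseteq> topspace (bw_star_topology UNIV norm)"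
    using closedin_bw_star_UNIV closedin_subset by blast
qed

text \<open>
By definition a bounded-weak*-closed set meets the ball in a weak*-closed set; this is how weak*-compactness
of balls carries over to the bounded weak* topology.
\<close>

lemma continuous_map_weak_star_ball_bw_star:
  assumes t: "0 < t"
  shows "continuous_map
    (subtopology (weak_star_topology UNIV norm) (dual_ball t :: ('f::complex_normed_vector \<Rightarrow> complex) set))
    (bw_star_topology UNIV norm) id"
  unfolding continuous_map_closedin
proof (intro conjI allI impI)
  let ?B = "dual_ball t :: ('f \<Rightarrow> complex) set"
  have top: "topspace (subtopology (weak_star_topology UNIV norm) ?B) = ?B"
    by (auto simp: cball_on_def)
  show "id \<in> topspace (subtopology (weak_star_topology UNIV norm) ?B) \<rightarrow>
      topspace (bw_star_topology UNIV norm)"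
    unfolding top topspace_bw_star_UNIV by (auto simp: cball_on_def)
  fix A :: "('f \<Rightarrow> complex) set" assume "closedin (bw_star_topology UNIV norm) A"
  then have "closedin (weak_star_topology UNIV norm) (A \<inter> ?B)"
    using t by (simp add: closedin_bw_star_UNIV bw_star_closed_def)
  then have "closedin (subtopology (weak_star_topology UNIV norm) ?B) (A \<inter> ?B)"
    by (rule closedin_subset_topspace) simp
  moreover have "{x \<in> topspace (subtopology (weak_star_topology UNIV norm) ?B). id x \<in> A} = A \<inter> ?B"
    unfolding top by auto
  ultimately show "closedin (subtopology (weak_star_topology UNIV norm) ?B)
      {x \<in> topspace (subtopology (weak_star_topology UNIV norm) ?B). id x \<in> A}" by simp
qed

text \<open>
The bounded weak* topology is final with respect to the inclusions of the balls.
\<close>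

lemma bw_star_continuousI:
  fixes g :: "('f::complex_normed_vector \<Rightarrow> complex) \<Rightarrow> 'b"
  assumes "\<And>t. 0 < t \<Longrightarrow>
    continuous_map (subtopology (weak_star_topology UNIV norm) (dual_ball t)) X g"
  shows "continuous_map (bw_star_topology UNIV norm) X g"
  unfolding continuous_map_closedin topspace_bw_star_UNIV
proof (intro conjI allI impI)
  have top: "topspace (subtopology (weak_star_topology UNIV norm) (dual_ball t)) =
      (dual_ball t :: ('f \<Rightarrow> complex) set)" for t
    by (auto simp: cball_on_def)
  show "g \<in> cdual UNIV norm \<rightarrow> topspace X"
  proof
    fix \<phi> :: "'f \<Rightarrow> complex" assume "\<phi> \<in> cdual UNIV norm"
    then obtain t where "0 < t" "\<phi> \<in> dual_ball t" by (rule cdual_in_dual_ball)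
    then show "g \<phi> \<in> topspace X"
      using continuous_map_funspace[OF assms, of t] unfolding top by blast
  qed
  fix C assume C: "closedin X C"
  have "closedin (weak_star_topology UNIV norm) ({\<phi> \<in> cdual UNIV norm. g \<phi> \<in> C} \<inter> dual_ball t)"
    if t: "0 < t" for t
  proof -
    have "closedin (subtopology (weak_star_topology UNIV norm) (dual_ball t)) {\<phi> \<in> dual_ball t. g \<phi> \<in> C}"
      using closedin_continuous_map_preimage[OF assms[OF t] C] unfolding top .
    then have "closedin (weak_star_topology UNIV norm) {\<phi> \<in> dual_ball t. g \<phi> \<in> C}"
      by (rule closedin_trans_full) (rule closedin_dual_ball[OF less_imp_le[OF t]])
    moreover have "{\<phi> \<in> dual_ball t. g \<phi> \<in> C} = {\<phi> \<in> cdual UNIV norm. g \<phi> \<in> C} \<inter> dual_ball t"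
      by (auto simp: cball_on_def)
    ultimately show ?thesis by simp
  qed
  then show "closedin (bw_star_topology UNIV norm) {\<phi> \<in> cdual UNIV norm. g \<phi> \<in> C}"
    unfolding closedin_bw_star_UNIV bw_star_closed_def by blast
qed

section \<open>Compactness of the range, of the transpose and of the linearization\<close>

text \<open>
If z is a centre near f x, then \<phi> and \<psi> in the ball differ at f x by their difference at z and an error
proportional to t * norm (f x - z). Finitely many centres serve all x, and closeness at finitely many
points is a weak* neighbourhood.
\<close>

lemma weak_star_continuous_on_balls:
  fixes f :: "'e::complex_normed_vector \<Rightarrow> 'f::complex_normed_vector"
  assumes f: "f \<in> Hinf U" and K: "compact (closure (f ` U))" and t: "0 < t"
  shows "continuous_map (subtopology (weak_star_topology UNIV norm) (dual_ball t))
    (norm_topology (Hinf U) (sup_norm U)) (transpose_map f)"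
proof -
  interpret H: Metric_space "Hinf U :: ('e \<Rightarrow> complex) set" "norm_dist (Hinf U) (sup_norm U)"
    by (rule Metric_space_Hinf)
  let ?W = "weak_star_topology UNIV (norm :: 'f \<Rightarrow> real)"
  have ball: "\<phi> \<in> cdual UNIV norm" if "\<phi> \<in> dual_ball t" for \<phi> :: "'f \<Rightarrow> complex"
    using that by (simp add: cball_on_def)
  show ?thesis
    unfolding norm_topology_def H.continuous_map_to_metric
  proof (intro ballI allI impI)
    fix \<phi> and e :: real assume "\<phi> \<in> topspace (subtopology ?W (dual_ball t))" and e: "0 < e"
    then have \<phi>: "\<phi> \<in> dual_ball t" by simp
    \<comment> \<open>Two errors of size e / 8 and one of size e / 4 leave the strict inequality at e.\<close>
    have "0 < e / (8 * t)" using e t by simp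
    then obtain k where k: "finite k" "\<And>y. y \<in> f ` U \<Longrightarrow> \<exists>z\<in>k. dist y z < e / (8 * t)"
      using compact_finite_net[OF K, of "e / (8 * t)"] by metis
    define G where "G = (\<Inter>z\<in>k. {\<psi> \<in> cdual UNIV norm. \<psi> z \<in> ball (\<phi> z) (e / 4)}) \<inter> topspace ?W"
    have "openin ?W G"
      unfolding G_def by (intro openin_INT k(1) openin_weak_star_basic UNIV_I open_ball)
    then have "openin (subtopology ?W (dual_ball t)) (dual_ball t \<inter> G)"
      by (rule openin_subtopology_Int2)
    moreover have "\<phi> \<in> dual_ball t \<inter> G"
      using \<phi> ball[OF \<phi>] e by (simp add: G_def)
    moreover have "transpose_map f \<psi> \<in> H.mball (transpose_map f \<phi>) e" if \<psi>: "\<psi> \<in> dual_ball t \<inter> G" for \<psi>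
    proof -
      have \<psi>b: "\<psi> \<in> dual_ball t" using \<psi> by blast
      have "cmod (\<phi> (f x) - \<psi> (f x)) \<le> e / 2" if "x \<in> U" for x
      proof -
        obtain z where z: "z \<in> k" "norm (f x - z) < e / (8 * t)"
          using k(2)[of "f x"] \<open>x \<in> U\<close> by (auto simp: dist_norm)
        have small: "cmod (\<theta> (f x - z)) \<le> e / 8" if "\<theta> \<in> dual_ball t" for \<theta> :: "'f \<Rightarrow> complex"
        proof -
          have "cmod (\<theta> (f x - z)) \<le> t * norm (f x - z)"
            using that t by (simp add: dual_ball_iff)
          also have "\<dots> \<le> t * (e / (8 * t))"
            using z(2) t by (intro mult_left_mono) auto
          finally show ?thesis using t by simp
        qed
        have "cmod (\<phi> z - \<psi> z) < e / 4"
          using \<psi> z(1) by (simp add: G_def dist_norm)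
        moreover have "\<phi> (f x) - \<psi> (f x) = \<phi> (f x - z) + (\<phi> z - \<psi> z) - \<psi> (f x - z)"
          by (simp add: linear_diff[OF dual_ball_linear[OF \<phi>]] linear_diff[OF dual_ball_linear[OF \<psi>b]])
        then have "cmod (\<phi> (f x) - \<psi> (f x)) \<le>
            cmod (\<phi> (f x - z)) + cmod (\<phi> z - \<psi> z) + cmod (\<psi> (f x - z))"
          by (smt (verit) norm_triangle_ineq norm_triangle_ineq4)
        ultimately show ?thesis using small[OF \<phi>] small[OF \<psi>b] by linarith
      qed
      then have "sup_norm U (transpose_map f \<phi> - transpose_map f \<psi>) \<le> e / 2"
        using e by (intro sup_norm_le Hinf_diff transpose_in_Hinf[OF f] ball \<phi> \<psi>b)
          (auto simp: transpose_map_def)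
      then show ?thesis
        using e transpose_in_Hinf[OF f ball[OF \<phi>]] transpose_in_Hinf[OF f ball[OF \<psi>b]]
        by (simp add: norm_dist_def)
    qed
    ultimately show "\<exists>V. openin (subtopology ?W (dual_ball t)) V \<and> \<phi> \<in> V \<and>
        (\<forall>\<psi>\<in>V. transpose_map f \<psi> \<in> H.mball (transpose_map f \<phi>) e)" by blast
  qed
qed

text \<open>
By the Banach-Alaoglu theorem the image of the dual unit ball is itself compact, and therefore equal to
its closure.
\<close>

lemma compact_op_transpose_if_bw_star_continuous:
  fixes f :: "'e::complex_normed_vector \<Rightarrow> 'f::complex_normed_vector"
  assumes f: "f \<in> Hinf U"
    and cont: "continuous_map (bw_star_topology UNIV norm) (norm_topology (Hinf U) (sup_norm U))
      (transpose_map f)"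
  shows "compact_op (cdual UNIV norm) (cdual_norm UNIV norm) (Hinf U) (sup_norm U) (transpose_map f)"
proof -
  interpret H: Metric_space "Hinf U :: ('e \<Rightarrow> complex) set" "norm_dist (Hinf U) (sup_norm U)"
    by (rule Metric_space_Hinf)
  let ?B = "dual_ball 1 :: ('f \<Rightarrow> complex) set"
  have "compactin (subtopology (weak_star_topology UNIV norm) ?B) ?B"
    using Banach_Alaoglu[of 1] by (simp add: compactin_subtopology)
  then have "compactin (bw_star_topology UNIV norm) (id ` ?B)"
    by (rule image_compactin[OF _ continuous_map_weak_star_ball_bw_star]) simp
  then have "compactin (norm_topology (Hinf U) (sup_norm U)) (transpose_map f ` id ` ?B)"
    by (rule image_compactin[OF _ cont])
  then have compact: "compactin (norm_topology (Hinf U) (sup_norm U)) (transpose_map f ` ?B)"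
    by simp
  then have "closedin (norm_topology (Hinf U) (sup_norm U)) (transpose_map f ` ?B)"
    unfolding norm_topology_def by (rule compactin_imp_closedin[OF H.Hausdorff_space_mtopology])
  then show ?thesis
    using compact bounded_op_transpose_map[OF f] by (simp add: compact_op_def closure_of_closedin)
qed

lemma compact_op_transpose_net:
  fixes f :: "'e::complex_normed_vector \<Rightarrow> 'f::complex_normed_vector"
  assumes c: "compact_op (cdual UNIV norm) (cdual_norm UNIV norm) (Hinf U) (sup_norm U) (transpose_map f)"
    and e: "0 < e"
  shows "\<exists>k\<subseteq>dual_ball 1. finite k \<and>
    (\<forall>\<phi>\<in>dual_ball 1. \<exists>\<psi>\<in>k. sup_norm U (transpose_map f \<phi> - transpose_map f \<psi>) \<le> e)"
proof -
  interpret H: Metric_space "Hinf U :: ('e \<Rightarrow> complex) set" "norm_dist (Hinf U) (sup_norm U)"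
    by (rule Metric_space_Hinf)
  let ?S = "transpose_map f ` dual_ball 1"
  have "transpose_map f ` cdual UNIV norm \<subseteq> Hinf U"
    using c unfolding compact_op_def bounded_op_def by (elim conjE)
  moreover have "?S \<subseteq> transpose_map f ` cdual UNIV norm"
    by (intro image_mono) (auto simp: cball_on_def)
  ultimately have "?S \<subseteq> Hinf U" by (rule order_trans[rotated])
  then have "?S \<subseteq> H.mtopology closure_of ?S"
    by (intro closure_of_subset) simp
  moreover have "compactin H.mtopology (H.mtopology closure_of ?S)"
    using c unfolding compact_op_def norm_topology_def by (elim conjE)
  ultimately have "H.mtotally_bounded ?S"
    by (intro H.mtotally_bounded_subset[OF H.compactin_imp_mtotally_bounded])
  then obtain N where N: "finite N" "N \<subseteq> ?S" "?S \<subseteq> (\<Union>g\<in>N. H.mball g e)"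
    unfolding H.mtotally_bounded_def using e by metis
  obtain k where k: "k \<subseteq> dual_ball 1" "finite k" "N = transpose_map f ` k"
    using finite_subset_image[OF N(1,2)] by metis
  have "\<exists>\<psi>\<in>k. sup_norm U (transpose_map f \<phi> - transpose_map f \<psi>) \<le> e" if \<phi>: "\<phi> \<in> dual_ball 1" for \<phi>
  proof -
    have "transpose_map f \<phi> \<in> (\<Union>\<psi>\<in>k. H.mball (transpose_map f \<psi>) e)"
      using subsetD[OF N(3) imageI[OF \<phi>]] unfolding k(3) by simp
    then obtain \<psi> where \<psi>: "\<psi> \<in> k" "transpose_map f \<phi> \<in> H.mball (transpose_map f \<psi>) e"
      by (rule UN_E)
    then have "norm_dist (Hinf U) (sup_norm U) (transpose_map f \<phi>) (transpose_map f \<psi>) \<le> e"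
      "transpose_map f \<phi> \<in> Hinf U" "transpose_map f \<psi> \<in> Hinf U"
      by (simp_all add: H.commute)
    then have "sup_norm U (transpose_map f \<phi> - transpose_map f \<psi>) \<le> e"
      by (simp add: norm_dist_def)
    then show ?thesis using \<psi>(1) by (rule bexI)
  qed
  with k(1,2) show ?thesis by metis
qed

text \<open>
Compactness of the transpose gives, for the pairing of \<phi> and u by u (\<phi> \<circ> f), finite nets of functionals that
work uniformly for u in the unit ball. Exchanging the variables gives finite nets of elements u that
work uniformly for \<phi> in the dual ball, and such a net is a norm net for the images T u.
\<close>

lemma compact_op_linearization_if_transpose:
  fixes f :: "'e::complex_normed_vector \<Rightarrow> 'f::complex_banach"
  assumes f: "f \<in> Hinf U"
    and c: "compact_op (cdual UNIV norm) (cdual_norm UNIV norm) (Hinf U) (sup_norm U) (transpose_map f)"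
  shows "compact_op (Ginf U) (Hinf_dual_norm U) UNIV norm (linearization U f)"
proof -
  let ?T = "linearization U f" and ?B = "cball_on (Ginf U) (Hinf_dual_norm U) 1"
  have B: "u \<in> Ginf U" "u \<in> Hinf_dual U" "\<And>g. g \<in> Hinf U \<Longrightarrow> cmod (u g) \<le> sup_norm U g"
    if "u \<in> ?B" for u
  proof -
    show "u \<in> Ginf U" using that by (simp add: cball_on_def)
    then show "u \<in> Hinf_dual U" using Ginf_subset_dual by blast
    then have "u \<in> cball_on (Hinf_dual U) (Hinf_dual_norm U) 1" using that by (simp add: cball_on_def)
    then show "cmod (u g) \<le> sup_norm U g" if "g \<in> Hinf U" for g
      using cball_cdual_iff[OF homogeneous_on_Hinf zero_le_one, of u U] that by simp
  qed
  have ball: "\<phi> \<in> cdual UNIV norm" if "\<phi> \<in> dual_ball 1" for \<phi> :: "'f \<Rightarrow> complex"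
    using that by (simp add: cball_on_def)
  have "compact (closure (?T ` ?B))"
  proof (rule compact_closure_if_finite_nets)
    fix e :: real assume e: "0 < e"
    obtain l where l: "l \<subseteq> ?B" "finite l"
      "\<And>u. u \<in> ?B \<Longrightarrow> \<exists>v\<in>l. \<forall>\<phi>\<in>(dual_ball 1 :: ('f \<Rightarrow> complex) set). cmod (u (transpose_map f \<phi>) - v (transpose_map f \<phi>)) \<le> e"
    proof (rule finite_net_transpose[of "dual_ball 1 :: ('f \<Rightarrow> complex) set" ?B "\<lambda>\<phi> u. u (transpose_map f \<phi>)" "sup_norm U f" e])
      fix \<phi> :: "'f \<Rightarrow> complex" and u assume "\<phi> \<in> dual_ball 1" "u \<in> ?B"
      then show "cmod (u (transpose_map f \<phi>)) \<le> sup_norm U f"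
        using B(3)[OF _ transpose_in_Hinf[OF f ball]] sup_norm_transpose_le[OF f zero_le_one]
        by fastforce
    next
      fix d :: real assume "0 < d"
      then obtain k :: "('f \<Rightarrow> complex) set" where k: "k \<subseteq> dual_ball 1" "finite k"
        "\<And>\<phi>. \<phi> \<in> dual_ball 1 \<Longrightarrow> \<exists>\<psi>\<in>k. sup_norm U (transpose_map f \<phi> - transpose_map f \<psi>) \<le> d"
        using compact_op_transpose_net[OF c, of d] by metis
      have "\<exists>\<psi>\<in>k. \<forall>u\<in>?B. cmod (u (transpose_map f \<phi>) - u (transpose_map f \<psi>)) \<le> d"
        if \<phi>: "\<phi> \<in> dual_ball 1" for \<phi>
      proof -
        obtain \<psi> where \<psi>: "\<psi> \<in> k" "sup_norm U (transpose_map f \<phi> - transpose_map f \<psi>) \<le> d"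
          using k(3)[OF \<phi>] by blast
        have \<psi>b: "\<psi> \<in> dual_ball 1" using \<psi>(1) k(1) by blast
        have "cmod (u (transpose_map f \<phi>) - u (transpose_map f \<psi>)) \<le> d" if u: "u \<in> ?B" for u
          unfolding Hinf_dual_transpose_diff[OF B(2)[OF u] f ball[OF \<phi>] ball[OF \<psi>b]]
          using B(3)[OF u Hinf_diff[OF transpose_in_Hinf[OF f ball[OF \<phi>]] transpose_in_Hinf[OF f ball[OF \<psi>b]]]] \<psi>(2)
          by linarith
        then show ?thesis using \<psi>(1) by blast
      qed
      then show "\<exists>k\<subseteq>dual_ball 1. finite k \<and> (\<forall>\<phi>\<in>(dual_ball 1 :: ('f \<Rightarrow> complex) set). \<exists>\<psi>\<in>k. \<forall>u\<in>?B.
          cmod (u (transpose_map f \<phi>) - u (transpose_map f \<psi>)) \<le> d)"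
        using k(1,2) by blast
    qed (use e in auto)
    have "\<exists>z\<in>?T ` l. norm (y - z) \<le> e" if "y \<in> ?T ` ?B" for y
    proof -
      obtain u where u: "u \<in> ?B" "y = ?T u" using \<open>y \<in> ?T ` ?B\<close> by blast
      obtain v where v: "v \<in> l"
        "\<And>\<phi>. \<phi> \<in> dual_ball 1 \<Longrightarrow> cmod (u (transpose_map f \<phi>) - v (transpose_map f \<phi>)) \<le> e"
        using l(3)[OF u(1)] by blast
      have vB: "v \<in> ?B" using v(1) l(1) by blast
      have "norm (?T u - ?T v) \<le> e"
      proof (rule norm_le_dual_ball)
        fix \<phi> :: "'f \<Rightarrow> complex" assume \<phi>: "\<phi> \<in> dual_ball 1"
        show "cmod (\<phi> (?T u - ?T v)) \<le> e"
          using v(2)[OF \<phi>] linear_diff[OF dual_ball_linear[OF \<phi>]]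
            linearization_transpose[OF f B(1)[OF u(1)] ball[OF \<phi>]]
            linearization_transpose[OF f B(1)[OF vB] ball[OF \<phi>]] by simp
      qed
      then show ?thesis using v(1) u(2) by blast
    qed
    then show "\<exists>k. finite k \<and> (\<forall>y\<in>?T ` ?B. \<exists>z\<in>k. norm (y - z) \<le> e)"
      using l(2) by blast
  qed
  then show ?thesis
    using bounded_op_linearization[OF f]
    by (simp add: compact_op_def norm_topology_UNIV euclidean_closure_of)
qed

lemma compact_range_if_compact_op_linearization:
  fixes f :: "'e::complex_normed_vector \<Rightarrow> 'f::complex_banach"
  assumes f: "f \<in> Hinf U"
    and c: "compact_op (Ginf U) (Hinf_dual_norm U) UNIV norm (linearization U f)"
  shows "compact (closure (f ` U))"
proof -
  let ?TB = "linearization U f ` cball_on (Ginf U) (Hinf_dual_norm U) 1"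
  have "f x \<in> ?TB" if "x \<in> U" for x
    using linearization_evaluation[OF f that] evaluation_in_Ginf[OF that] evaluation_in_unit_ball[OF that]
    by (intro image_eqI[of _ _ "evaluation U x"]) (auto simp: cball_on_def)
  then have "closure (f ` U) \<subseteq> closure ?TB"
    by (intro closure_mono) blast
  moreover have "compact (closure ?TB)"
    using c by (simp add: compact_op_def norm_topology_UNIV euclidean_closure_of)
  ultimately show ?thesis
    using closed_closure compact_Int_closed[of "closure ?TB" "closure (f ` U)"] by (simp add: Int_absorb1)
qed

section \<open>Weak continuity of the transpose\<close>

lemma continuous_map_norm_weak:
  "continuous_map (norm_topology (Hinf U) (sup_norm U))
    (weak_topology (Hinf U) (sup_norm U :: ('e::complex_normed_vector \<Rightarrow> complex) \<Rightarrow> real)) id"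
proof -
  interpret H: Metric_space "Hinf U :: ('e \<Rightarrow> complex) set" "norm_dist (Hinf U) (sup_norm U)"
    by (rule Metric_space_Hinf)
  show ?thesis
    unfolding weak_topology_def norm_topology_def
  proof (rule continuous_on_generated_topo)
    fix W assume "W \<in> {{g \<in> Hinf U. u g \<in> S} | u S. u \<in> Hinf_dual U \<and> open S}"
    then obtain u S where W: "W = {g \<in> Hinf U. u g \<in> S}" and u: "u \<in> Hinf_dual U" and S: "open S"
      by blast
    have "\<exists>r>0. H.mball g r \<subseteq> W" if g: "g \<in> W" for g
    proof -
      have gH: "g \<in> Hinf U" "u g \<in> S" using g by (auto simp: W)
      obtain e where e: "0 < e" "ball (u g) e \<subseteq> S" using S gH(2) by (auto simp: open_contains_ball)
      define C where "C = Hinf_dual_norm U u + 1"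
      have C: "0 < C" using cdual_norm_nonneg[OF homogeneous_on_Hinf u] by (simp add: C_def)
      have "h \<in> W" if h: "h \<in> H.mball g (e / C)" for h
      proof -
        have hH: "h \<in> Hinf U" "sup_norm U (g - h) < e / C"
          using h by (auto simp: norm_dist_def)
        have d: "g - h \<in> Hinf U" by (rule Hinf_diff[OF gH(1) hH(1)])
        have "u g = u (g - h) + u h"
          using Hinf_dual_add[OF u d hH(1)] by simp
        then have "cmod (u g - u h) \<le> Hinf_dual_norm U u * sup_norm U (g - h)"
          using Hinf_dual_bound[OF u d] by simp
        also have "\<dots> \<le> C * sup_norm U (g - h)"
          using sup_norm_nonneg[OF Hinf_bounded[OF d]] by (simp add: C_def mult_right_mono)
        also have "\<dots> < e" using hH(2) C by (simp add: pos_less_divide_eq mult.commute)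
        finally have "u h \<in> ball (u g) e" by (simp add: dist_norm)
        then show "h \<in> W" using e(2) hH(1) by (auto simp: W)
      qed
      then show ?thesis using e(1) C by (intro exI[of _ "e / C"]) auto
    qed
    moreover have "id -` W \<inter> topspace H.mtopology = W" by (auto simp: W)
    ultimately show "openin H.mtopology (id -` W \<inter> topspace H.mtopology)"
      by (auto simp: H.openin_mtopology W)
  next
    have "\<Union> {{g \<in> Hinf U. u g \<in> S} | u S. u \<in> Hinf_dual U \<and> open S} = Hinf U"
      using topspace_weak_topology[of "Hinf U" "sup_norm U"]
      unfolding weak_topology_def topology_generated_by_topspace .
    then show "id ` topspace H.mtopology \<subseteq> \<Union> {{g \<in> Hinf U. u g \<in> S} | u S. u \<in> Hinf_dual U \<and> open S}"
      by simp
  qed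
qed

text \<open>
The functional \<Psi> is the real part of \<phi> \<mapsto> u (\<phi> \<circ> f), read on real functionals. On the annihilator N of a finite
net of the range, every \<phi> \<circ> f is uniformly small, so \<Psi> is bounded there by e times the norm. If h extends
the restriction of \<Psi> to N with the same bound, then \<Psi> - h vanishes on N and is evaluation at a point y, which
approximates \<Psi> up to e. The net is enlarged by the multiples by i because g vanishes at z and i z exactly
if its complexification vanishes at z.
\<close>

lemma Hinf_dual_represented:
  fixes f :: "'e::complex_normed_vector \<Rightarrow> 'f::complex_banach"
  assumes f: "f \<in> Hinf U" and K: "compact (closure (f ` U))" and u: "u \<in> Hinf_dual U"
  obtains y where "\<And>\<phi>. \<phi> \<in> cdual UNIV norm \<Longrightarrow> u (transpose_map f \<phi>) = \<phi> y"
proof (rule representable_functional[of "\<lambda>\<phi>. u (transpose_map f \<phi>)"])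
  show hom: "u (transpose_map f (a *\<^sub>C \<phi>)) = a * u (transpose_map f \<phi>)"
    if "\<phi> \<in> cdual UNIV norm" for a \<phi>
    by (simp add: transpose_map_scaleC Hinf_dual_scaleC[OF u transpose_in_Hinf[OF f that]])
  fix e :: real assume e: "0 < e"
  \<comment> \<open>Adding 1 keeps M positive when u vanishes.\<close>
  define M where "M = Hinf_dual_norm U u + 1"
  have M: "0 < M" using cdual_norm_nonneg[OF homogeneous_on_Hinf u] by (simp add: M_def)
  then have "0 < e / M" using e by simp
  then obtain k where k: "finite k" "\<And>y. y \<in> f ` U \<Longrightarrow> \<exists>z\<in>k. dist y z < e / M"
    using compact_finite_net[OF K, of "e / M"] by metis
  define k' where "k' = k \<union> (\<lambda>z. \<i> *\<^sub>C z) ` k"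
  define \<Psi> where "\<Psi> = (\<lambda>g. Re (u (transpose_map f (complexify g))))"
  note H = transpose_in_Hinf[OF f complexify_cdual]
  have lin: "linear \<Psi>"
  proof (rule linearI)
    show "\<Psi> (g + h) = \<Psi> g + \<Psi> h" for g h
      by (simp add: \<Psi>_def complexify_add transpose_map_add Hinf_dual_add[OF u H H])
    show "\<Psi> (r *\<^sub>R g) = r *\<^sub>R \<Psi> g" for r g
      by (simp add: \<Psi>_def complexify_scaleR hom[OF complexify_cdual])
  qed
  define N where "N = {g :: 'f \<Rightarrow>\<^sub>L real. \<forall>z\<in>k'. blinfun_apply g z = 0}"
  have N: "subspace N"
    by (auto simp: N_def subspace_def blinfun.add_left blinfun.scaleR_left)
  have small: "\<Psi> g \<le> e * norm g" if g: "g \<in> N" for g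
  proof -
    have zero: "complexify g z = 0" if "z \<in> k" for z
      using g that by (simp add: N_def k'_def complexify_def complex_eq_iff)
    have "cmod (transpose_map f (complexify g) x) \<le> e / M * norm g" if "x \<in> U" for x
    proof -
      obtain z where z: "z \<in> k" "norm (f x - z) < e / M"
        using k(2)[of "f x"] \<open>x \<in> U\<close> by (auto simp: dist_norm)
      have "complexify g (f x) = complexify g (f x - z)"
        using zero[OF z(1)] by (simp add: linear_diff[OF dual_ball_linear[OF complexify_dual_ball]])
      also have "cmod \<dots> \<le> norm g * norm (f x - z)"
        using complexify_dual_ball[of g] by (simp add: dual_ball_iff)
      also have "\<dots> \<le> norm g * (e / M)"
        using z(2) by (intro mult_left_mono) auto
      finally show ?thesis by (simp add: transpose_map_def mult.commute)
    qed
    then have sup: "sup_norm U (transpose_map f (complexify g)) \<le> e / M * norm g"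
      using e M by (intro sup_norm_le[OF H]) auto
    have "\<Psi> g \<le> cmod (u (transpose_map f (complexify g)))"
      unfolding \<Psi>_def by (rule complex_Re_le_cmod)
    also have "\<dots> \<le> Hinf_dual_norm U u * sup_norm U (transpose_map f (complexify g))"
      by (rule Hinf_dual_bound[OF u H])
    also have "\<dots> \<le> M * (e / M * norm g)"
      using sup sup_norm_nonneg[OF Hinf_bounded[OF H[of g]]] M
      by (intro mult_mono) (auto simp: M_def)
    finally show ?thesis using M by simp
  qed
  obtain h where h: "linear h" "\<And>g. g \<in> N \<Longrightarrow> h g = \<Psi> g" "\<And>g. h g \<le> e * norm g"
    using Hahn_Banach_sublinear[OF sublinear_norm N lin small] e by (metis less_imp_le)
  have "\<exists>y. \<forall>g. \<Psi> g - h g = blinfun_apply g y"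
  proof (rule evaluation_if_vanishes_on_annihilator)
    show "finite k'" using k(1) by (simp add: k'_def)
    show "linear (\<lambda>g. \<Psi> g - h g)" by (rule linear_compose_sub[OF lin h(1)])
  qed (use h(2) in \<open>simp add: N_def\<close>)
  then obtain y where y: "\<And>g. \<Psi> g - h g = blinfun_apply g y" by blast
  have "cmod (u (transpose_map f \<phi>) - \<phi> y) \<le> e" if \<phi>: "\<phi> \<in> dual_ball 1" for \<phi>
  proof -
    define w where "w = u (transpose_map f \<phi>) - \<phi> y"
    \<comment> \<open>Rotating \<phi> makes the error real, so that the estimate for real parts applies.\<close>
    define c where "c = cnj (sgn w)"
    have c: "cmod c \<le> 1" by (simp add: c_def norm_sgn)
    have cw: "c * w = complex_of_real (cmod w)"
      using complex_norm_square[of w] by (cases "w = 0") (simp_all add: c_def sgn_eq field_simps power2_eq_square)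
    have \<phi>D: "\<phi> \<in> cdual UNIV norm" using \<phi> by (simp add: cball_on_def)
    have "c *\<^sub>C \<phi> \<in> dual_ball 1"
      using dual_ball_scaleC[OF zero_le_one \<phi>, of c] c by (simp add: cball_on_def)
    then obtain g where g: "complexify g = c *\<^sub>C \<phi>" "norm g \<le> 1" "\<And>x. blinfun_apply g x = Re ((c *\<^sub>C \<phi>) x)"
      using dual_ball_complexify[OF zero_le_one] by metis
    have "cmod w = Re (c * u (transpose_map f \<phi>)) - Re (c * \<phi> y)"
      using arg_cong[OF cw, of Re] by (simp add: w_def algebra_simps)
    also have "\<dots> = \<Psi> g - blinfun_apply g y"
      by (simp only: \<Psi>_def g(1,3) hom[OF \<phi>D]) (simp add: scaleC_fun_def scaleC_complex_def)
    also have "\<dots> = h g" using y[of g] by simp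
    also have "\<dots> \<le> e * norm g" by (rule h(3))
    also have "\<dots> \<le> e" using g(2) e by (simp add: mult_left_le)
    finally show ?thesis by (simp add: w_def)
  qed
  then show "\<exists>y. \<forall>\<phi>\<in>dual_ball 1. cmod (u (transpose_map f \<phi>) - \<phi> y) \<le> e" by blast
qed (rule that)

text \<open>
By the representation, the preimage of a subbasic weakly open set is a subbasic weak*-open set.
\<close>

lemma weak_star_weak_continuous:
  fixes f :: "'e::complex_normed_vector \<Rightarrow> 'f::complex_banach"
  assumes f: "f \<in> Hinf U" and K: "compact (closure (f ` U))"
  shows "continuous_map (weak_star_topology UNIV norm) (weak_topology (Hinf U) (sup_norm U)) (transpose_map f)"
  unfolding weak_topology_def
proof (rule continuous_on_generated_topo)
  let ?W = "weak_star_topology UNIV (norm :: 'f \<Rightarrow> real)"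
  fix W assume "W \<in> {{g \<in> Hinf U. u g \<in> S} | u S. u \<in> Hinf_dual U \<and> open S}"
  then obtain u S where W: "W = {g \<in> Hinf U. u g \<in> S}" and u: "u \<in> Hinf_dual U" and S: "open S"
    by blast
  obtain y where y: "\<And>\<phi>. \<phi> \<in> cdual UNIV norm \<Longrightarrow> u (transpose_map f \<phi>) = \<phi> y"
    using Hinf_dual_represented[OF f K u] by metis
  have "transpose_map f -` W \<inter> topspace ?W = {\<phi> \<in> cdual UNIV norm. \<phi> y \<in> S}"
    using transpose_in_Hinf[OF f] y by (auto simp: W)
  then show "openin ?W (transpose_map f -` W \<inter> topspace ?W)"
    using openin_weak_star_basic[of y UNIV S norm] S by simp
next
  have "\<Union> {{g \<in> Hinf U. u g \<in> S} | u S. u \<in> Hinf_dual U \<and> open S} = Hinf U"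
    using topspace_weak_topology[of "Hinf U" "sup_norm U"]
    unfolding weak_topology_def topology_generated_by_topspace .
  then show "transpose_map f ` topspace (weak_star_topology UNIV norm) \<subseteq>
      \<Union> {{g \<in> Hinf U. u g \<in> S} | u S. u \<in> Hinf_dual U \<and> open S}"
    using transpose_in_Hinf[OF f] by auto
qed

theorem theorem2p2:
  fixes U :: "'e::complex_banach set"
    and f :: "'e \<Rightarrow> 'f::complex_banach"
  assumes "open U" and "f \<in> Hinf U"
  shows
    "(compact (closure (f ` U)) \<longleftrightarrow>
        compact_op (Ginf U) (Hinf_dual_norm U) UNIV norm (linearization U f)) \<and>
     (compact (closure (f ` U)) \<longleftrightarrow>
        compact_op (cdual UNIV norm) (cdual_norm UNIV norm) (Hinf U) (sup_norm U)
          (transpose_map f)) \<and>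
     (compact (closure (f ` U)) \<longleftrightarrow>
        continuous_map (bw_star_topology UNIV norm) (norm_topology (Hinf U) (sup_norm U))
          (transpose_map f)) \<and>
     (compact (closure (f ` U)) \<longleftrightarrow>
        compact_op (cdual UNIV norm) (cdual_norm UNIV norm) (Hinf U) (sup_norm U)
          (transpose_map f) \<and>
        continuous_map (bw_star_topology UNIV norm) (weak_topology (Hinf U) (sup_norm U))
          (transpose_map f)) \<and>
     (compact (closure (f ` U)) \<longleftrightarrow>
        compact_op (cdual UNIV norm) (cdual_norm UNIV norm) (Hinf U) (sup_norm U)
          (transpose_map f) \<and>
        continuous_map (weak_star_topology UNIV norm) (weak_topology (Hinf U) (sup_norm U))
          (transpose_map f))"
    (is "(?range \<longleftrightarrow> ?lin) \<and> (?range \<longleftrightarrow> ?transpose) \<and> (?range \<longleftrightarrow> ?bw_norm) \<and>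
      (?range \<longleftrightarrow> ?transpose \<and> ?bw_weak) \<and> (?range \<longleftrightarrow> ?transpose \<and> ?ws_weak)")
proof -
  note f = assms(2)
  have bw_norm: ?bw_norm if ?range
    by (rule bw_star_continuousI[OF weak_star_continuous_on_balls[OF f that]])
  have transpose: ?transpose if ?bw_norm
    by (rule compact_op_transpose_if_bw_star_continuous[OF f that])
  have lin: ?lin if ?transpose
    by (rule compact_op_linearization_if_transpose[OF f that])
  have range: ?range if ?lin
    by (rule compact_range_if_compact_op_linearization[OF f that])
  have bw_weak: ?bw_weak if ?bw_norm
    using continuous_map_compose[OF that continuous_map_norm_weak] by simp
  have ws_weak: ?ws_weak if ?range
    by (rule weak_star_weak_continuous[OF f that])
  show ?thesis
    using bw_norm transpose lin range bw_weak ws_weak by blast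
qed

end
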